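(* Let $U$ be a finite set, and let $g_{1}:\mathcal{F}_{1}\to \mathbf{Z}$ and $g_{2}:\mathcal{F}_{2}\to \mathbf{Z}$ be intersecting-supermodular functions on $U$ such that $|X|\geq g_{i}(X)$ for every $i\in\{1,2\}$ and every $X\in \mathcal{F}_{i}$. Let $\Sigma$ be a set of colors and $L:U\to 2^{\Sigma}$ be such that each $u\in U$ has a list $L(u)$ of exactly $\max\{d[g_{1}](u), d[g_{2}](u)\}$ colors. Then there exists a list supermodular coloring for $(g_{1}, g_{2}, L)$, i.e., a function $\phi:U\to\Sigma$ with $\phi(u)\in L(u)$ for all $u\in U$ and $|\phi(X)|\geq g_{i}(X)$ for every $i\in\{1,2\}$ and every $X\in\mathcal{F}_{i}$.
   Context: Two sets $X,Y\subseteq U$ are intersecting if none of $X\cap Y$, $X\setminus Y$, $Y\setminus X$ is empty. A family $\mathcal{F}\subseteq 2^{U}$ is an intersecting family if every intersecting pair $X,Y\in\mathcal{F}$ satisfies $X\cup Y, X\cap Y\in\mathcal{F}$. A function $g:\mathcal{F}\to\mathbf{Z}$ is intersecting-supermodular if $\mathcal{F}$ is an intersecting family and $g(X)+g(Y)\leq g(X\cup Y)+g(X\cap Y)$ for every intersecting pair $X,Y\in\mathcal{F}$. For a function $\phi$ on $U$, $\phi(X):=\{\phi(u)\mid u\in X\}$. For an intersecting-supermodular $g:\mathcal{F}\to\mathbf{Z}$, the effective set family is $\mathcal{E}[g]:=\{X\in\mathcal{F}\mid g(X)\geq 2,\ \text{there is no } X'\in\mathcal{F} \text{ with } X'\subsetneq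 X \text{ and } g(X')\geq g(X)\}$, and $d[g]:U\to\mathbf{N}$ is defined by $d[g](u)=\max\{1,\max\{g(X)\mid u\in X\in\mathcal{E}[g]\}\}$, where the inner maximum is $-\infty$ if no $X\in\mathcal{E}[g]$ contains $u$. *)

theory Defs
  imports Main "HOL-Library.FuncSet"
begin

definition intersecting :: "'a set \<Rightarrow> 'a set \<Rightarrow> bool" where
  "intersecting X Y \<longleftrightarrow> X \<inter> Y \<noteq> {} \<and> X - Y \<noteq> {} \<and> Y - X \<noteq> {}"

definition intersecting_family :: "'a set \<Rightarrow> 'a set set \<Rightarrow> bool" where
  "intersecting_family U F \<longleftrightarrow>
     F \<subseteq> Pow U \<and>
     (\<forall>X\<in>F. \<forall>Y\<in>F. intersecting X Y \<longrightarrow> X \<union> Y \<in> F \<and> X \<inter> Y \<in> F)"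

text \<open>A function \<open>F \<rightarrow> \<int>\<close> is represented by a total function on sets; only its values on
  the members of \<open>F\<close> matter in the definitions below.\<close>

definition intersecting_supermodular ::
    "'a set \<Rightarrow> 'a set set \<Rightarrow> ('a set \<Rightarrow> int) \<Rightarrow> bool" where
  "intersecting_supermodular U F g \<longleftrightarrow>
     intersecting_family U F \<and>
     (\<forall>X\<in>F. \<forall>Y\<in>F. intersecting X Y \<longrightarrow> g X + g Y \<le> g (X \<union> Y) + g (X \<inter> Y))"

definition effective_family :: "'a set set \<Rightarrow> ('a set \<Rightarrow> int) \<Rightarrow> 'a set set" where
  "effective_family F g = {X \<in> F. g X \<ge> 2 \<and> \<not> (\<exists>X'\<in>F. X' \<subset> X \<and> g X' \<ge> g X)}"

text \<open>Inserting \<open>1\<close> in the set implements both the outer maximum and the convention that the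
  inner maximum is \<open>-\<infinity>\<close> when no effective set contains \<open>u\<close>. The set is finite whenever \<open>F\<close> is.\<close>

definition eff_demand :: "'a set set \<Rightarrow> ('a set \<Rightarrow> int) \<Rightarrow> 'a \<Rightarrow> nat" where
  "eff_demand F g u = nat (Max (insert 1 {g X |X. X \<in> effective_family F g \<and> u \<in> X}))"

definition list_supermodular_coloring ::
    "'a set \<Rightarrow> 'a set set \<Rightarrow> ('a set \<Rightarrow> int) \<Rightarrow> 'a set set \<Rightarrow> ('a set \<Rightarrow> int) \<Rightarrow>
     'c set \<Rightarrow> ('a \<Rightarrow> 'c set) \<Rightarrow> ('a \<Rightarrow> 'c) \<Rightarrow> bool" where
  "list_supermodular_coloring U F1 g1 F2 g2 S L \<phi> \<longleftrightarrow>
     \<phi> \<in> U \<rightarrow> S \<and>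
     (\<forall>u\<in>U. \<phi> u \<in> L u) \<and>
     (\<forall>X\<in>F1. int (card (\<phi> ` X)) \<ge> g1 X) \<and>
     (\<forall>X\<in>F2. int (card (\<phi> ` X)) \<ge> g2 X)"

end

theory Submission
  imports Defs
begin

text \<open>
  Give every element \<open>u\<close> a deadline on each side; a set meets its demand if sufficiently many of its
  elements can be given distinct time slots before their deadlines, a condition on the rank function
  of a laminar matroid. If both deadline functions meet all demands and the lists satisfy
  \<open>|L(u)| \<ge> f1(u) + f2(u) - 1\<close>, the elements are coloured one colour at a time, as in Galvin's
  theorem: among the candidates for the colour, a stable pair (deferred acceptance between the two
  sides) provides a colour class whose contraction keeps all demands met while every rejected
  candidate loses a unit of deadline on some side. Submodularity of the rank makes the minimal
  deficient sets disjoint, and one suitable element from each of them repairs all deficits.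

  Deadlines with \<open>f1 + f2 - 1 \<le> max(d1, d2)\<close> are found by induction. The inclusion-minimal sets of
  maximum demand are disjoint on each side; an alternating path argument yields a set \<open>K\<close>
  that, after contraction, lowers the maximum on part of the ground set. It is put first on one side
  and last on the other.
\<close>

section \<open>The rank function of a deadline matroid\<close>

text \<open>If all lists had one length \<open>k\<close>, deadlines could be read off a single
  colouring \<open>c\<close> with colours 1 to \<open>k\<close> that meets all demands:
  \<open>c\<close> and \<open>k + 1 - c\<close> are feasible and add up to \<open>k + 1\<close>.
  Such a reversal is too expensive here, since an element of small demand has a short list even if
  \<open>k\<close> is large. So the two functions are built together, and \<open>k\<close> is spent
  only around the sets of maximum demand. The obstacle is that \<open>K\<close> cannot always hit
  each of these sets exactly once on both sides. If a maximum matching between the two families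
  leaves a set unmatched, only the part reachable from it is treated, and one extra element is added
  to the matching. It may double a choice on the other side, which is harmless unless both elements
  lie in a set whose demand equals its size; a count of the classes of this relation provides a
  suitable element.\<close>

text \<open>By the min-max formula, \<open>rk f X\<close> is the largest size of a subset of \<open>X\<close> that has, for every
  \<open>j\<close>, at most \<open>j\<close> elements with deadline at most \<open>j\<close>.\<close>

definition rk :: "('a \<Rightarrow> nat) \<Rightarrow> 'a set \<Rightarrow> nat" where
  "rk f X = (INF j. j + card {u \<in> X. j < f u})"

lemma rk_le: "rk f X \<le> j + card {u \<in> X. j < f u}"
  unfolding rk_def by (rule cINF_lower) auto

lemma rk_attained: obtains j where "rk f X = j + card {u \<in> X. j < f u}"
proof -
  have "rk f X \<in> range (\<lambda>j. j + card {u \<in> X. j < f u})"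
    unfolding rk_def by (rule Inf_nat_def1) auto
  then show ?thesis using that by auto
qed

lemma le_rk_iff: "n \<le> int (rk f X) \<longleftrightarrow> (\<forall>j. n \<le> int (j + card {u \<in> X. j < f u}))"
proof (intro iffI allI)
  fix j assume "n \<le> int (rk f X)"
  then show "n \<le> int (j + card {u \<in> X. j < f u})"
    using rk_le[of f X j] by linarith
next
  assume *: "\<forall>j. n \<le> int (j + card {u \<in> X. j < f u})"
  obtain j where "rk f X = j + card {u \<in> X. j < f u}" by (rule rk_attained)
  then show "n \<le> int (rk f X)" using * by simp
qed

lemma rk_mono:
  assumes "finite Y" "X \<subseteq> Y" "\<And>u. u \<in> X \<Longrightarrow> f u \<le> h u"
  shows "rk f X \<le> rk h Y"
proof -
  obtain j where j: "rk h Y = j + card {u \<in> Y. j < h u}" by (rule rk_attained)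
  have "card {u \<in> X. j < f u} \<le> card {u \<in> Y. j < h u}"
    using assms by (intro card_mono) (auto intro: less_le_trans)
  then show ?thesis using rk_le[of f X j] j by linarith
qed

lemma rk_le_card: "finite X \<Longrightarrow> rk f X \<le> card X"
  using rk_le[of f X 0] card_mono[of X "{u \<in> X. 0 < f u}"] by auto

text \<open>Uncrossing of minimising levels \<open>j \<le> l\<close> of the two sets: the larger
  level bounds the rank of the union, the smaller one that of the intersection.\<close>

lemma rk_submodular:
  assumes "finite X" "finite Y"
  shows "rk f (X \<union> Y) + rk f (X \<inter> Y) \<le> rk f X + rk f Y"
proof -
  have *: "rk f (X \<union> Y) + rk f (X \<inter> Y) \<le> (j + card {u \<in> X. j < f u}) + (l + card {u \<in> Y. l < f u})"
    if "j \<le> l" "finite X" "finite Y" for j l and X Y :: "'a set"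
  proof -
    let ?A = "{u \<in> X. j < f u}" and ?B = "{u \<in> Y. l < f u}"
    have "card {u \<in> X \<union> Y. l < f u} + card {u \<in> X \<inter> Y. j < f u}
        = card ({u \<in> X \<union> Y. l < f u} \<union> {u \<in> X \<inter> Y. j < f u})
          + card ({u \<in> X \<union> Y. l < f u} \<inter> {u \<in> X \<inter> Y. j < f u})"
      using that by (intro card_Un_Int) auto
    also have "\<dots> \<le> card (?A \<union> ?B) + card (?A \<inter> ?B)"
      using that by (intro add_mono card_mono) auto
    also have "\<dots> = card ?A + card ?B"
      using that by (intro card_Un_Int[symmetric]) auto
    finally show ?thesis using rk_le[of f "X \<union> Y" l] rk_le[of f "X \<inter> Y" j] by linarith
  qed
  obtain j where j: "rk f X = j + card {u \<in> X. j < f u}" by (rule rk_attained)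
  obtain l where l: "rk f Y = l + card {u \<in> Y. l < f u}" by (rule rk_attained)
  show ?thesis
  proof (cases "j \<le> l")
    case True
    then show ?thesis using *[OF True assms] j l by linarith
  next
    case False
    then have "l \<le> j" by simp
    from *[OF this assms(2,1)] show ?thesis using j l by (simp add: Un_commute Int_commute)
  qed
qed

lemma rk_Diff_single:
  assumes "finite X"
  shows "rk f X \<le> Suc (rk f (X - {w}))"
proof -
  obtain j where j: "rk f (X - {w}) = j + card {u \<in> X - {w}. j < f u}" by (rule rk_attained)
  have "card {u \<in> X. j < f u} \<le> card (insert w {u \<in> X - {w}. j < f u})"
    using assms by (intro card_mono) auto
  also have "\<dots> \<le> Suc (card {u \<in> X - {w}. j < f u})" by (rule card_insert_le_m1) auto
  finally show ?thesis using rk_le[of f X j] j by linarith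
qed

text \<open>In the deadline matroid, an element of \<open>Y\<close> whose deadline does not exceed the least
  critical level of \<open>Y\<close> lies in a circuit inside \<open>Y\<close>.\<close>

definition crit :: "('a \<Rightarrow> nat) \<Rightarrow> 'a set \<Rightarrow> nat" where
  "crit f Y = (LEAST j. rk f Y = j + card {u \<in> Y. j < f u})"

lemma rk_crit: "rk f Y = crit f Y + card {u \<in> Y. crit f Y < f u}"
  proof -
  have "\<exists>j. rk f Y = j + card {u \<in> Y. j < f u}" using rk_attained[of f Y] by blast
  then show ?thesis unfolding crit_def by (rule LeastI_ex)
qed

text \<open>Deleting \<open>w\<close> lowers the bound only at levels below \<open>f w\<close>.
  These lie below the least minimising level, so the bound there exceeds the rank and has a unit to
  spare.\<close>

lemma rk_remove_below_crit:
  assumes "finite Y" "f w \<le> crit f Y"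
  shows "rk f (Y - {w}) = rk f Y"
proof (rule antisym)
  show "rk f (Y - {w}) \<le> rk f Y" using assms by (intro rk_mono) auto
  obtain j where j: "rk f (Y - {w}) = j + card {u \<in> Y - {w}. j < f u}" by (rule rk_attained)
  show "rk f Y \<le> rk f (Y - {w})"
  proof (cases "j < f w")
    case True
    then have "j < crit f Y" using assms by simp
    then have "rk f Y \<noteq> j + card {u \<in> Y. j < f u}"
      unfolding crit_def by (rule not_less_Least)
    then have "rk f Y < j + card {u \<in> Y. j < f u}" using rk_le[of f Y j] by linarith
    moreover have "card {u \<in> Y. j < f u} \<le> Suc (card {u \<in> Y - {w}. j < f u})"
    proof -
      have "card {u \<in> Y. j < f u} \<le> card (insert w {u \<in> Y - {w}. j < f u})"
        using assms by (intro card_mono) auto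
      also have "\<dots> \<le> Suc (card {u \<in> Y - {w}. j < f u})" by (rule card_insert_le_m1) auto
      finally show ?thesis .
    qed
    ultimately show ?thesis using j by linarith
  next
    case False
    then have "{u \<in> Y. j < f u} = {u \<in> Y - {w}. j < f u}" by auto
    then show ?thesis using j rk_le[of f Y j] by simp
  qed
qed

definition dec :: "('a \<Rightarrow> nat) \<Rightarrow> 'a set \<Rightarrow> 'a \<Rightarrow> nat" where
  "dec f X u = (if u \<in> X then f u - 1 else f u)"

lemma rk_dec:
  assumes "finite Y"
  shows "rk f Y \<le> Suc (rk (dec f X) Y)"
proof -
  obtain j where j: "rk (dec f X) Y = j + card {u \<in> Y. j < dec f X u}" by (rule rk_attained)
  have "card {u \<in> Y. Suc j < f u} \<le> card {u \<in> Y. j < dec f X u}"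
    using assms by (intro card_mono) (auto simp: dec_def)
  then show ?thesis using rk_le[of f Y "Suc j"] j by linarith
qed

section \<open>Demand systems\<close>

text \<open>A requirement function is represented by the set of its pairs (set, value). Allowing several
  values for one set makes the reduction \<open>contract\<close> an image, with no maximum over fibres. The
  singleton demands ensure that every deadline is positive.\<close>

definition demands :: "'a set \<Rightarrow> ('a set \<times> int) set \<Rightarrow> bool" where
  "demands U D \<longleftrightarrow> finite U \<and> (\<forall>X n. (X, n) \<in> D \<longrightarrow> X \<subseteq> U \<and> n \<le> int (card X)) \<and>
     (\<forall>u\<in>U. ({u}, 1) \<in> D) \<and>
     (\<forall>X m Y n. (X, m) \<in> D \<longrightarrow> (Y, n) \<in> D \<longrightarrow> intersecting X Y \<longrightarrow>
        (\<exists>p q. (X \<union> Y, p) \<in> D \<and> (X \<inter> Y, q) \<in> D \<and> m + n \<le> p + q))"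

definition meets :: "'a set \<Rightarrow> 'a set \<Rightarrow> int" where
  "meets K X = (if X \<inter> K = {} then 0 else 1)"

definition contract :: "'a set \<Rightarrow> ('a set \<times> int) set \<Rightarrow> ('a set \<times> int) set" where
  "contract K D = {(X - K, n - meets K X) | X n. (X, n) \<in> D}"

lemma contractI: "(X, n) \<in> D \<Longrightarrow> (X - K, n - meets K X) \<in> contract K D"
  unfolding contract_def by blast

lemma demandsD:
  assumes "demands U D"
  shows "finite U"
    and "(X, n) \<in> D \<Longrightarrow> X \<subseteq> U"
    and "(X, n) \<in> D \<Longrightarrow> finite X"
    and "(X, n) \<in> D \<Longrightarrow> n \<le> int (card X)"
    and "u \<in> U \<Longrightarrow> ({u}, 1) \<in> D"
  using assms unfolding demands_def by (auto intro: finite_subset)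

lemma demands_supermodular:
  assumes "demands U D" "(X, m) \<in> D" "(Y, n) \<in> D" "intersecting X Y"
  obtains p q where "(X \<union> Y, p) \<in> D" "(X \<inter> Y, q) \<in> D" "m + n \<le> p + q"
  using assms unfolding demands_def by blast

lemma meets_submodular: "meets K (X \<union> Y) + meets K (X \<inter> Y) \<le> meets K X + meets K Y"
  by (auto simp: meets_def)

lemma meets_bounds: "0 \<le> meets K X" "meets K X \<le> 1"
  by (auto simp: meets_def)

text \<open>\<open>meets K\<close> is submodular, so subtracting it preserves supermodularity; sets
  that intersect after deleting \<open>K\<close> did so before.\<close>

lemma demands_contract:
  assumes "demands U D" and "\<And>X n. (X, n) \<in> D \<Longrightarrow> n - meets K X \<le> int (card (X - K))"
  shows "demands (U - K) (contract K D)"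
  unfolding demands_def
proof (intro conjI allI impI ballI)
  show "finite (U - K)" using demandsD[OF assms(1)] by auto
  fix u assume "u \<in> U - K"
  then have "({u}, 1) \<in> D" "{u} - K = {u}" "1 - meets K {u} = 1"
    using demandsD[OF assms(1)] by (auto simp: meets_def)
  then show "({u}, 1) \<in> contract K D" using contractI[of "{u}" 1 D K] by simp
next
  fix X n assume "(X, n) \<in> contract K D"
  then show "X \<subseteq> U - K" "n \<le> int (card X)"
    using demandsD(2)[OF assms(1)] assms(2) unfolding contract_def by auto
next
  fix X m Y n
  assume XY: "(X, m) \<in> contract K D" "(Y, n) \<in> contract K D" "intersecting X Y"
  then obtain X' m' Y' n' where *: "(X', m') \<in> D" "X = X' - K" "m = m' - meets K X'"
    "(Y', n') \<in> D" "Y = Y' - K" "n = n' - meets K Y'"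
    unfolding contract_def by auto
  have "intersecting X' Y'" using XY(3) * by (auto simp: intersecting_def)
  then obtain p q where pq: "(X' \<union> Y', p) \<in> D" "(X' \<inter> Y', q) \<in> D" "m' + n' \<le> p + q"
    using demands_supermodular[OF assms(1) *(1,4)] by blast
  have "X \<union> Y = (X' \<union> Y') - K" "X \<inter> Y = (X' \<inter> Y') - K" using * by auto
  then have "(X \<union> Y, p - meets K (X' \<union> Y')) \<in> contract K D"
    "(X \<inter> Y, q - meets K (X' \<inter> Y')) \<in> contract K D"
    using contractI[OF pq(1)] contractI[OF pq(2)] by simp_all
  moreover have "m + n \<le> (p - meets K (X' \<union> Y')) + (q - meets K (X' \<inter> Y'))"
    using meets_submodular[of K X' Y'] * pq by linarith
  ultimately show "\<exists>p q. (X \<union> Y, p) \<in> contract K D \<and> (X \<inter> Y, q) \<in> contract K D \<and> m + n \<le> p + q"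
    by blast
qed

section \<open>Hitting the deficient sets\<close>

text \<open>The common core of two repairs. In \<open>valid_grow\<close> the set \<open>B\<close> is
  empty and \<open>\<rho>\<close> is a rank; in \<open>valid_shrink\<close> the set \<open>B\<close>
  holds the elements that must stay chosen, and \<open>\<rho>\<close> already credits them with one
  unit.\<close>

locale deficient_rank =
  fixes U :: "'a set" and D :: "('a set \<times> int) set" and B :: "'a set" and \<rho> :: "'a set \<Rightarrow> int"
  assumes dem: "demands U D"
    and mono: "X \<subseteq> Y \<Longrightarrow> Y \<subseteq> U \<Longrightarrow> \<rho> X \<le> \<rho> Y"
    and submodular: "X \<subseteq> U \<Longrightarrow> Y \<subseteq> U \<Longrightarrow> \<rho> (X \<union> Y) + \<rho> (X \<inter> Y) \<le> \<rho> X + \<rho> Y"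
    and unit: "X \<subseteq> U \<Longrightarrow> \<rho> X \<le> \<rho> (X - {w}) + 1"
    and deficit_le_1: "(X, n) \<in> D \<Longrightarrow> n \<le> \<rho> X + 1"
    and deficit_le_0: "(X, n) \<in> D \<Longrightarrow> X \<inter> B \<noteq> {} \<Longrightarrow> n \<le> \<rho> X"
begin

definition mindef :: "'a set set" where
  "mindef = {Y. (Y, \<rho> Y + 1) \<in> D \<and> (\<forall>X n. (X, n) \<in> D \<longrightarrow> X \<subset> Y \<longrightarrow> n \<le> \<rho> X)}"

lemma mindef_subset: "Y \<in> mindef \<Longrightarrow> Y \<subseteq> U"
  using demandsD(2)[OF dem] by (auto simp: mindef_def)

lemma finite_mindef: "finite mindef"
  by (rule finite_subset[of _ "Pow U"]) (use mindef_subset demandsD(1)[OF dem] in auto)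

lemma mindef_avoids: "Y \<in> mindef \<Longrightarrow> Y \<inter> B = {}"
  using deficit_le_0 by (fastforce simp: mindef_def)

text \<open>Two crossing minimal deficient sets have total deficit 2, but their intersection has
  none by minimality and their union at most 1.\<close>

lemma mindef_disjoint:
  assumes "Y \<in> mindef" "Y' \<in> mindef" "Y \<noteq> Y'"
  shows "Y \<inter> Y' = {}"
proof (rule ccontr)
  assume meet: "Y \<inter> Y' \<noteq> {}"
  have "\<not> Y \<subset> Y'" "\<not> Y' \<subset> Y" using assms by (fastforce simp: mindef_def)+
  with assms(3) have sub: "\<not> Y \<subseteq> Y'" "\<not> Y' \<subseteq> Y" by auto
  then have int: "intersecting Y Y'" using meet by (auto simp: intersecting_def)
  have D: "(Y, \<rho> Y + 1) \<in> D" "(Y', \<rho> Y' + 1) \<in> D" using assms by (auto simp: mindef_def)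
  obtain p q where pq: "(Y \<union> Y', p) \<in> D" "(Y \<inter> Y', q) \<in> D" "(\<rho> Y + 1) + (\<rho> Y' + 1) \<le> p + q"
    using demands_supermodular[OF dem D int] .
  have "Y \<inter> Y' \<subset> Y" using sub by auto
  then have "q \<le> \<rho> (Y \<inter> Y')" using pq(2) assms(1) by (auto simp: mindef_def)
  moreover have "p \<le> \<rho> (Y \<union> Y') + 1" by (rule deficit_le_1[OF pq(1)])
  moreover have "\<rho> (Y \<union> Y') + \<rho> (Y \<inter> Y') \<le> \<rho> Y + \<rho> Y'"
    by (intro submodular mindef_subset assms)
  ultimately show False using pq(3) by linarith
qed

lemma contains_mindef:
  assumes "(Z, \<rho> Z + 1) \<in> D"
  obtains Y where "Y \<in> mindef" "Y \<subseteq> Z"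
proof -
  let ?S = "{Y. Y \<subseteq> Z \<and> (Y, \<rho> Y + 1) \<in> D}"
  have "finite ?S" using demandsD(3)[OF dem assms] by auto
  moreover have "Z \<in> ?S" using assms by auto
  ultimately obtain Y where "Y \<in> ?S" "\<forall>X\<in>?S. X \<subseteq> Y \<longrightarrow> Y = X"
    using finite_has_minimal[of ?S] by (metis (no_types, lifting) empty_iff)
  then have Y: "Y \<in> ?S" "\<And>X. X \<in> ?S \<Longrightarrow> X \<subseteq> Y \<Longrightarrow> X = Y" by auto
  have "n \<le> \<rho> X" if "(X, n) \<in> D" "X \<subset> Y" for X n
  proof (rule ccontr)
    assume "\<not> n \<le> \<rho> X"
    then have "n = \<rho> X + 1" using deficit_le_1[OF that(1)] by linarith
    then have "X \<in> ?S" using that Y(1) by auto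
    then show False using Y(2) that(2) by blast
  qed
  then have "Y \<in> mindef" using Y(1) by (auto simp: mindef_def)
  then show ?thesis using that Y(1) by auto
qed

text \<open>Merging the members of \<open>Q\<close> into \<open>Z\<close> one by one gains a unit of
  deficit each time, since \<open>Y\<close> has deficit 1 and its proper subset
  \<open>Z \<inter> Y\<close> has none; yet the final union has deficit at most 1, and none if it
  meets \<open>B\<close>. If \<open>Z \<subseteq> Y\<close>, disjointness leaves no further member
  of \<open>Q\<close> and minimality of \<open>Y\<close> suffices.\<close>

lemma crossing_bound:
  assumes "finite Q" "Q \<subseteq> mindef" "(Z, n) \<in> D"
    and "\<And>Y. Y \<in> Q \<Longrightarrow> Y \<inter> Z \<noteq> {} \<and> \<not> Y \<subseteq> Z"
  shows "n + int (card Q) \<le> \<rho> Z + 1 - meets B Z"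
  using assms
proof (induction Q arbitrary: Z n rule: finite_induct)
  case empty
  then show ?case using deficit_le_1[OF empty(2)] deficit_le_0[OF empty(2)]
    by (auto simp: meets_def)
next
  case (insert Y Q)
  have Y: "Y \<in> mindef" "(Y, \<rho> Y + 1) \<in> D" using insert.prems(1) by (auto simp: mindef_def)
  have YB: "Y \<inter> B = {}" by (rule mindef_avoids[OF Y(1)])
  show ?case
  proof (cases "Z \<subseteq> Y")
    case True
    have "Q = {}"
    proof (rule ccontr)
      assume "Q \<noteq> {}"
      then obtain Y' where "Y' \<in> Q" by auto
      then have "Y' \<inter> Z \<noteq> {}" "Y' \<inter> Y = {}"
        using insert.prems insert.hyps mindef_disjoint[of Y' Y] by auto
      then show False using True by auto
    qed
    moreover have "Z \<subset> Y" using True insert.prems(3)[of Y] by auto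
    then have "n \<le> \<rho> Z" using Y insert.prems(2) by (auto simp: mindef_def)
    moreover have "Z \<inter> B = {}" using True YB by auto
    ultimately show ?thesis by (simp add: meets_def)
  next
    case False
    then have int: "intersecting Z Y"
      using insert.prems(3)[of Y] by (auto simp: intersecting_def)
    obtain p q where pq: "(Z \<union> Y, p) \<in> D" "(Z \<inter> Y, q) \<in> D" "n + (\<rho> Y + 1) \<le> p + q"
      using demands_supermodular[OF dem insert.prems(2) Y(2) int] .
    have "p + int (card Q) \<le> \<rho> (Z \<union> Y) + 1 - meets B (Z \<union> Y)"
    proof (rule insert.IH)
      show "Q \<subseteq> mindef" using insert.prems by auto
      fix Y' assume Y': "Y' \<in> Q"
      then have "Y' \<inter> Y = {}"
        using insert.prems(1) insert.hyps mindef_disjoint[of Y' Y] by auto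
      then show "Y' \<inter> (Z \<union> Y) \<noteq> {} \<and> \<not> Y' \<subseteq> Z \<union> Y"
        using insert.prems(3)[of Y'] Y' by auto
    qed (rule pq)
    moreover have "meets B (Z \<union> Y) = meets B Z" using YB by (auto simp: meets_def)
    moreover have "q \<le> \<rho> (Z \<inter> Y)"
    proof -
      have "Z \<inter> Y \<subset> Y" using insert.prems(3)[of Y] by auto
      then show ?thesis using Y(1) pq(2) by (auto simp: mindef_def)
    qed
    moreover have "\<rho> (Z \<union> Y) + \<rho> (Z \<inter> Y) \<le> \<rho> Z + \<rho> Y"
      by (intro submodular mindef_subset Y demandsD(2)[OF dem insert.prems(2)])
    ultimately show ?thesis using pq(3) insert.hyps by simp
  qed
qed

text \<open>By disjointness \<open>Y\<close> stays intact when the other representatives are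
  deleted. As \<open>w Y\<close> is spanned by the rest of \<open>Y\<close>, submodularity makes it
  spanned in every larger set.\<close>

lemma remove_spanned:
  assumes "finite R" "R \<subseteq> mindef" "Z \<subseteq> U" "\<And>Y. Y \<in> R \<Longrightarrow> Y \<subseteq> Z"
    and w: "\<And>Y. Y \<in> mindef \<Longrightarrow> w Y \<in> Y \<and> \<rho> (Y - {w Y}) = \<rho> Y"
  shows "\<rho> (Z - w ` R) = \<rho> Z"
  using assms(1,2,4)
proof (induction R rule: finite_induct)
  case empty
  then show ?case by simp
next
  case (insert Y R)
  let ?T = "Z - w ` R"
  have Y: "Y \<in> mindef" using insert.prems by auto
  have "Y \<inter> w ` R = {}"
  proof -
    have "w Y' \<notin> Y" if "Y' \<in> R" for Y'
      using mindef_disjoint[of Y Y'] w[of Y'] insert.hyps insert.prems that by blast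
    then show ?thesis by auto
  qed
  then have sub: "Y \<subseteq> ?T" using insert.prems by auto
  then have un: "Y \<union> (?T - {w Y}) = ?T" and int: "Y \<inter> (?T - {w Y}) = Y - {w Y}"
    using w[OF Y] by auto
  have "\<rho> ?T + \<rho> (Y - {w Y}) \<le> \<rho> Y + \<rho> (?T - {w Y})"
  proof -
    have "?T - {w Y} \<subseteq> U" using assms(3) by auto
    then show ?thesis using submodular[of Y "?T - {w Y}"] un int mindef_subset[OF Y] by simp
  qed
  then have "\<rho> ?T \<le> \<rho> (?T - {w Y})" using w[OF Y] by simp
  moreover have "\<rho> (?T - {w Y}) \<le> \<rho> ?T" using assms(3) by (intro mono) auto
  moreover have "\<rho> ?T = \<rho> Z" using insert by auto
  moreover have "Z - w ` insert Y R = ?T - {w Y}" by auto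
  ultimately show ?case by simp
qed

lemma remove_card:
  assumes "finite Q" "Z \<subseteq> U"
  shows "\<rho> Z \<le> \<rho> (Z - Q) + int (card Q)"
  using assms(1)
proof (induction Q rule: finite_induct)
  case empty
  then show ?case by simp
next
  case (insert x Q)
  have "\<rho> (Z - Q) \<le> \<rho> (Z - Q - {x}) + 1" using assms by (intro unit) auto
  moreover have "Z - insert x Q = Z - Q - {x}" by auto
  ultimately show ?case using insert by simp
qed

text \<open>Representatives of deficient sets inside \<open>Z\<close> are spanned and cost nothing;
  those of sets crossing \<open>Z\<close> cost one each, paid for by \<open>crossing_bound\<close>.
  If \<open>Z\<close> avoids \<open>B\<close> and all representatives, it contains no minimal
  deficient set and so has no deficit.\<close>

lemma hit_mindef:
  assumes Z: "(Z, n) \<in> D"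
    and w: "\<And>Y. Y \<in> mindef \<Longrightarrow> w Y \<in> Y \<and> \<rho> (Y - {w Y}) = \<rho> Y"
  shows "n \<le> \<rho> (Z - w ` mindef) + (if Z \<inter> B = {} then meets (w ` mindef) Z else 0)"
proof -
  let ?R = "{Y \<in> mindef. Y \<subseteq> Z}" and ?Q = "{Y \<in> mindef. w Y \<in> Z \<and> \<not> Y \<subseteq> Z}"
  have ZU: "Z \<subseteq> U" by (rule demandsD(2)[OF dem Z])
  have "n + int (card ?Q) \<le> \<rho> Z + 1 - meets B Z"
    by (rule crossing_bound[OF _ _ Z]) (use finite_mindef w in auto)
  moreover have "\<rho> (Z - w ` ?R) = \<rho> Z"
    by (rule remove_spanned) (use finite_mindef w ZU in auto)
  moreover have "\<rho> (Z - w ` ?R) \<le> \<rho> (Z - w ` ?R - w ` ?Q) + int (card (w ` ?Q))"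
    by (rule remove_card) (use finite_mindef ZU in auto)
  moreover have "Z - w ` ?R - w ` ?Q = Z - w ` mindef" by auto
  moreover have "card (w ` ?Q) \<le> card ?Q" by (rule card_image_le) (use finite_mindef in auto)
  ultimately have main: "n \<le> \<rho> (Z - w ` mindef) + 1 - meets B Z" by simp
  show ?thesis
  proof (cases "Z \<inter> B = {} \<and> Z \<inter> w ` mindef = {}")
    case True
    have "n \<noteq> \<rho> Z + 1"
    proof
      assume "n = \<rho> Z + 1"
      then obtain Y where "Y \<in> mindef" "Y \<subseteq> Z" using contains_mindef Z by blast
      then show False using True w[of Y] by auto
    qed
    then have "n \<le> \<rho> Z" using deficit_le_1[OF Z] by linarith
    moreover have "Z - w ` mindef = Z" using True by auto
    ultimately show ?thesis using True by (simp add: meets_def)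
  next
    case False
    then show ?thesis using main by (auto simp: meets_def split: if_splits)
  qed
qed

end

section \<open>Choice of a colour class on one side\<close>

text \<open>\<open>valid D f X K\<close>: if among the candidates \<open>X\<close> the set \<open>K\<close> is coloured now and
  the other candidates get their deadline decreased, the remaining demands stay feasible.\<close>

definition valid :: "('a set \<times> int) set \<Rightarrow> ('a \<Rightarrow> nat) \<Rightarrow> 'a set \<Rightarrow> 'a set \<Rightarrow> bool" where
  "valid D f X K \<longleftrightarrow> K \<subseteq> X \<and>
     (\<forall>Z n. (Z, n) \<in> D \<longrightarrow> n \<le> int (rk (dec f X) (Z - K)) + meets K Z)"

lemma validD: "valid D f X K \<Longrightarrow> (Z, n) \<in> D \<Longrightarrow> n \<le> int (rk (dec f X) (Z - K)) + meets K Z"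
  by (auto simp: valid_def)

definition feasible :: "('a set \<times> int) set \<Rightarrow> ('a \<Rightarrow> nat) \<Rightarrow> bool" where
  "feasible D f \<longleftrightarrow> (\<forall>X n. (X, n) \<in> D \<longrightarrow> n \<le> int (rk f X))"

lemma feasibleD: "feasible D f \<Longrightarrow> (X, n) \<in> D \<Longrightarrow> n \<le> int (rk f X)"
  by (auto simp: feasible_def)

lemma valid_empty: "feasible D f \<Longrightarrow> valid D f {} {}"
  by (simp add: valid_def feasible_def meets_def dec_def[abs_def])

text \<open>The new choice uses only the old one and the newcomers, so no rejected element returns.
  \<open>K'\<close> consists of representatives of the minimal deficient sets; a set without a
  spanned element in \<open>?S\<close> would contradict the validity of \<open>K\<close>.\<close>

lemma valid_grow:
  assumes dem: "demands U D" and "feasible D f" and XX': "X \<subseteq> X'" "X' \<subseteq> U"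
    and val: "valid D f X K"
  shows "\<exists>K'. valid D f X' K' \<and> K' \<subseteq> K \<union> (X' - X)"
proof -
  let ?r = "rk (dec f X')"
  let ?S = "K \<union> (X' - X)"
  note fin = finite_subset[OF _ demandsD(1)[OF dem]]
  interpret deficient_rank U D "{}" "\<lambda>Z. int (?r Z)"
  proof
    fix A B w assume "A \<subseteq> U"
    then show "int (?r A) \<le> int (?r (A - {w})) + 1" using rk_Diff_single[of A "dec f X'" w] fin by simp
  next
    fix A B assume "A \<subseteq> U" "B \<subseteq> U"
    then show "int (?r (A \<union> B)) + int (?r (A \<inter> B)) \<le> int (?r A) + int (?r B)"
      using rk_submodular[of A B "dec f X'"] fin by simp
  next
    fix A B assume "A \<subseteq> B" "B \<subseteq> U"
    then show "int (?r A) \<le> int (?r B)" using fin by (auto intro: rk_mono)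
  next
    fix A n assume A: "(A, n) \<in> D"
    show "n \<le> int (?r A) + 1"
      using feasibleD[OF assms(2) A] rk_dec[OF demandsD(3)[OF dem A], of f X'] by linarith
  qed (use dem in auto)
  have ex: "\<exists>w\<in>Y \<inter> ?S. ?r (Y - {w}) = ?r Y" if Y: "Y \<in> mindef" for Y
  proof (rule ccontr)
    assume neg: "\<not> ?thesis"
    let ?c = "crit (dec f X') Y"
    have YD: "(Y, int (?r Y) + 1) \<in> D" using Y by (auto simp: mindef_def)
    have fY: "finite Y" by (rule demandsD(3)[OF dem YD])
    \<comment> \<open>Elements that are not spanned lie above the critical level, so
      \<open>Y \<inter> ?S\<close> contributes its full size to the rank of
      \<open>Y\<close>.\<close>
    have high: "?c < dec f X' w" if "w \<in> Y \<inter> ?S" for w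
      using neg that rk_remove_below_crit[OF fY, of "dec f X'" w] by (meson not_le)
    have "card {u \<in> Y - ?S. ?c < dec f X' u} + card (Y \<inter> ?S) = card {u \<in> Y. ?c < dec f X' u}"
    proof -
      have "{u \<in> Y. ?c < dec f X' u} = {u \<in> Y - ?S. ?c < dec f X' u} \<union> (Y \<inter> ?S)"
        using high by auto
      then show ?thesis using fY by (simp only:) (subst card_Un_disjoint, auto)
    qed
    then have lower: "?r (Y - ?S) + card (Y \<inter> ?S) \<le> ?r Y"
      using rk_le[of "dec f X'" "Y - ?S" ?c] rk_crit[of "dec f X'" Y] by linarith
    let ?g = "rk (dec f X)"
    have "?g (Y - K) \<le> ?g (Y - ?S) + card (Y \<inter> (?S - K))"
    proof -
      obtain j where j: "?g (Y - ?S) = j + card {u \<in> Y - ?S. j < dec f X u}" by (rule rk_attained)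
      have "card {u \<in> Y - K. j < dec f X u} \<le> card ({u \<in> Y - ?S. j < dec f X u} \<union> (Y \<inter> (?S - K)))"
        using fY by (intro card_mono) auto
      also have "\<dots> \<le> card {u \<in> Y - ?S. j < dec f X u} + card (Y \<inter> (?S - K))" by (rule card_Un_le)
      finally show ?thesis using j rk_le[of "dec f X" "Y - K" j] by linarith
    qed
    \<comment> \<open>Outside \<open>?S\<close> the sets \<open>X\<close> and \<open>X'\<close>
      agree, hence so do the two decreased deadlines.\<close>
    moreover have "?g (Y - ?S) \<le> ?r (Y - ?S)"
      using fY XX' by (intro rk_mono) (auto simp: dec_def)
    moreover have "int (card (Y \<inter> (?S - K))) + meets K Y \<le> int (card (Y \<inter> ?S))"
    proof (cases "Y \<inter> K = {}")
      case True
      then show ?thesis using fY by (simp add: meets_def) (intro card_mono, auto)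
    next
      case False
      then have "card (Y \<inter> (?S - K)) < card (Y \<inter> ?S)"
        using fY by (intro psubset_card_mono) auto
      then show ?thesis using False by (simp add: meets_def)
    qed
    ultimately show False using lower validD[OF val YD] by linarith
  qed
  define w where "w Y = (SOME w. w \<in> Y \<inter> ?S \<and> ?r (Y - {w}) = ?r Y)" for Y
  have w: "w Y \<in> Y \<inter> ?S \<and> ?r (Y - {w Y}) = ?r Y" if "Y \<in> mindef" for Y
    unfolding w_def by (rule someI_ex) (use ex[OF that] in blast)
  have wS: "w ` mindef \<subseteq> ?S" using w by auto
  have "K \<subseteq> X" using val by (simp add: valid_def)
  moreover have "n \<le> int (?r (Z - w ` mindef)) + meets (w ` mindef) Z" if "(Z, n) \<in> D" for Z n
    using hit_mindef[OF that, of w] w by auto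
  ultimately have "valid D f X' (w ` mindef)"
    using subset_trans[OF wS, of X'] XX' by (auto simp: valid_def)
  then show ?thesis using wS by blast
qed

text \<open>When candidates leave, the chosen ones that remain can stay chosen. They form
  \<open>B\<close>, to which representatives of the minimal deficient sets are added.\<close>

lemma valid_shrink:
  assumes dem: "demands U D" and "feasible D f" and XX': "X' \<subseteq> X" "X \<subseteq> U"
    and val: "valid D f X K"
  shows "\<exists>K'. valid D f X' K' \<and> K \<inter> X' \<subseteq> K'"
proof -
  define B where "B = K \<inter> X'"
  let ?r = "rk (dec f X')"
  define \<rho> where "\<rho> Z = int (?r (Z - B)) + meets B Z" for Z
  note fin = finite_subset[OF _ demandsD(1)[OF dem]]
  have defB: "n \<le> \<rho> A" if A: "(A, n) \<in> D" "A \<inter> B \<noteq> {}" for A n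
  proof -
    have "finite A" by (rule demandsD(3)[OF dem A(1)])
    then have "rk (dec f X) (A - K) \<le> ?r (A - B)"
      using XX' by (intro rk_mono) (auto simp: B_def dec_def)
    moreover have "meets K A \<le> meets B A" using A(2) by (auto simp: meets_def B_def)
    ultimately show ?thesis using validD[OF val A(1)] by (simp add: \<rho>_def)
  qed
  interpret deficient_rank U D B \<rho>
  proof
    fix A C w assume A: "A \<subseteq> U"
    show "\<rho> A \<le> \<rho> (A - {w}) + 1"
    proof (cases "w \<in> B")
      case True
      then have "A - {w} - B = A - B" by auto
      then show ?thesis using meets_bounds[of B A] meets_bounds[of B "A - {w}"] by (simp add: \<rho>_def)
    next
      case False
      then have "meets B (A - {w}) = meets B A" by (auto simp: meets_def)
      moreover have "A - {w} - B = A - B - {w}" by auto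
      ultimately show ?thesis using rk_Diff_single[of "A - B" "dec f X'" w] A fin by (simp add: \<rho>_def)
    qed
  next
    fix A C assume "A \<subseteq> U" "C \<subseteq> U"
    then have "?r ((A - B) \<union> (C - B)) + ?r ((A - B) \<inter> (C - B)) \<le> ?r (A - B) + ?r (C - B)"
      using fin by (intro rk_submodular) auto
    moreover have "(A - B) \<union> (C - B) = (A \<union> C) - B" "(A - B) \<inter> (C - B) = (A \<inter> C) - B" by auto
    ultimately show "\<rho> (A \<union> C) + \<rho> (A \<inter> C) \<le> \<rho> A + \<rho> C"
      using meets_submodular[of B A C] by (simp add: \<rho>_def)
  next
    fix A C assume AC: "A \<subseteq> C" "C \<subseteq> U"
    then have "?r (A - B) \<le> ?r (C - B)" using fin by (intro rk_mono) auto
    moreover have "meets B A \<le> meets B C" using AC by (auto simp: meets_def)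
    ultimately show "\<rho> A \<le> \<rho> C" by (simp add: \<rho>_def)
  next
    fix A n assume A: "(A, n) \<in> D"
    show "n \<le> \<rho> A + 1"
    proof (cases "A \<inter> B = {}")
      case True
      then have "A - B = A" by auto
      then show ?thesis
        using feasibleD[OF assms(2) A] rk_dec[OF demandsD(3)[OF dem A], of f X'] True
        by (simp add: \<rho>_def meets_def)
    next
      case False
      then show ?thesis using defB[OF A] by simp
    qed
  qed (use dem defB in auto)
  have ex: "\<exists>w\<in>Y \<inter> X'. \<rho> (Y - {w}) = \<rho> Y" if Y: "Y \<in> mindef" for Y
  proof -
    let ?c = "crit (dec f X') Y"
    have YD: "(Y, \<rho> Y + 1) \<in> D" using Y by (auto simp: mindef_def)
    have fY: "finite Y" by (rule demandsD(3)[OF dem YD])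
    have YB: "Y \<inter> B = {}" by (rule mindef_avoids[OF Y])
    then have \<rho>: "\<rho> T = int (?r T)" if "T \<subseteq> Y" for T
    proof -
      have "T - B = T" "T \<inter> B = {}" using that YB by auto
      then show ?thesis by (simp add: \<rho>_def meets_def)
    qed
    \<comment> \<open>The decrease costs \<open>Y\<close> some rank, so an element of
      \<open>X'\<close> has dropped from above the critical level onto it and is now
      spanned.\<close>
    have "int (?r Y) < int (rk f Y)" using feasibleD[OF assms(2) YD] \<rho>[of Y] by simp
    then have "card {u \<in> Y. ?c < dec f X' u} < card {u \<in> Y. ?c < f u}"
      using rk_crit[of "dec f X'" Y] rk_le[of f Y ?c] by linarith
    then have "\<not> {u \<in> Y. ?c < f u} \<subseteq> {u \<in> Y. ?c < dec f X' u}"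
      using fY card_mono[of "{u \<in> Y. ?c < dec f X' u}" "{u \<in> Y. ?c < f u}"] by auto
    then obtain w where w: "w \<in> Y" "?c < f w" "\<not> ?c < dec f X' w" by blast
    then have wc: "dec f X' w \<le> ?c" by simp
    then have "w \<in> X'" using w(2) by (auto simp: dec_def split: if_splits)
    then show ?thesis using w rk_remove_below_crit[OF fY wc] \<rho>[of Y] \<rho>[of "Y - {w}"] by auto
  qed
  define w where "w Y = (SOME w. w \<in> Y \<inter> X' \<and> \<rho> (Y - {w}) = \<rho> Y)" for Y
  have w: "w Y \<in> Y \<inter> X' \<and> \<rho> (Y - {w Y}) = \<rho> Y" if "Y \<in> mindef" for Y
    unfolding w_def by (rule someI_ex) (use ex[OF that] in blast)
  let ?W = "w ` mindef"
  have WB: "?W \<inter> B = {}" using w mindef_avoids by blast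
  have "n \<le> int (?r (Z - (B \<union> ?W))) + meets (B \<union> ?W) Z" if "(Z, n) \<in> D" for Z n
  proof -
    have "n \<le> \<rho> (Z - ?W) + (if Z \<inter> B = {} then meets ?W Z else 0)"
      using hit_mindef[OF that, of w] w by auto
    moreover have "Z - ?W - B = Z - (B \<union> ?W)" by auto
    moreover have "(Z - ?W) \<inter> B = Z \<inter> B" using WB by auto
    then have "meets B (Z - ?W) = meets B Z" by (simp add: meets_def)
    ultimately show ?thesis by (auto simp: \<rho>_def meets_def split: if_splits)
  qed
  moreover have "B \<union> ?W \<subseteq> X'" using w by (auto simp: B_def)
  ultimately show ?thesis by (intro exI[of _ "B \<union> ?W"]) (auto simp: valid_def B_def)
qed

text \<open>Deferred acceptance: side 1 proposes, \<open>X2\<close> collects everything ever proposed, and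
  rejected elements leave \<open>X1\<close> for good.\<close>

lemma deferred_acceptance:
  assumes dem: "demands U D1" "demands U D2" and feas: "feasible D1 f1" "feasible D2 f2"
    and V: "V \<subseteq> U"
    and inv: "X1 \<union> X2 = V" "X1 \<inter> X2 = K2" "K2 \<subseteq> K1" "valid D1 f1 X1 K1" "valid D2 f2 X2 K2"
  shows "\<exists>X1 X2. X1 \<union> X2 = V \<and> valid D1 f1 X1 (X1 \<inter> X2) \<and> valid D2 f2 X2 (X1 \<inter> X2)"
  using inv
proof (induction "card (V - X2)" arbitrary: X1 X2 K1 K2 rule: less_induct)
  case less
  show ?case
  proof (cases "K1 = K2")
    case True
    then show ?thesis using less.prems by (intro exI[of _ X1] exI[of _ X2]) auto
  next
    case False
    have K1: "K1 \<subseteq> X1" using less.prems(4) by (simp add: valid_def)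
    have "X2 \<union> K1 \<subseteq> U" using less.prems K1 V by auto
    then obtain K2' where K2': "valid D2 f2 (X2 \<union> K1) K2'" "K2' \<subseteq> K2 \<union> (X2 \<union> K1 - X2)"
      using valid_grow[OF dem(2) feas(2) Un_upper1 _ less.prems(5)] by blast
    then have K2'K1: "K2' \<subseteq> K1" using less.prems(3) by auto
    let ?X1 = "X1 - (K1 - K2')"
    have "X1 \<subseteq> U" using less.prems(1) V by auto
    then obtain K1' where K1': "valid D1 f1 ?X1 K1'" "K1 \<inter> ?X1 \<subseteq> K1'"
      using valid_shrink[OF dem(1) feas(1) _ _ less.prems(4), of ?X1] by auto
    have "finite V" using V demandsD(1)[OF dem(1)] finite_subset by auto
    \<comment> \<open>Since \<open>K1 \<subseteq> X1\<close> and \<open>X1 \<inter> X2 = K2\<close>,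
      an element of \<open>K1\<close> outside \<open>K2\<close> is a new proposal.\<close>
    then have "card (V - (X2 \<union> K1)) < card (V - X2)"
      using False less.prems K1 by (intro psubset_card_mono) auto
    then show ?thesis
    proof (rule less.hyps)
      show "?X1 \<union> (X2 \<union> K1) = V" using less.prems K1 by auto
      show "?X1 \<inter> (X2 \<union> K1) = K2'" using less.prems K1 K2'K1 by auto
      show "K2' \<subseteq> K1'" using K1'(2) K1 K2'K1 by auto
    qed (rule K1' K2')+
  qed
qed

lemma stable_pair:
  assumes "demands U D1" "demands U D2" "feasible D1 f1" "feasible D2 f2" "V \<subseteq> U"
  shows "\<exists>X1 X2. X1 \<union> X2 = V \<and> valid D1 f1 X1 (X1 \<inter> X2) \<and> valid D2 f2 X2 (X1 \<inter> X2)"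
proof -
  obtain K where "valid D1 f1 V K"
    using valid_grow[OF assms(1,3) _ assms(5) valid_empty[OF assms(3)]] by auto
  then show ?thesis
    using deferred_acceptance[OF assms, of V "{}" "{}" K] valid_empty[OF assms(4)] by auto
qed

section \<open>List colouring from deadlines\<close>

definition dominates :: "('a set \<times> int) set \<Rightarrow> ('a \<Rightarrow> 'c) \<Rightarrow> bool" where
  "dominates D \<phi> \<longleftrightarrow> (\<forall>X n. (X, n) \<in> D \<longrightarrow> n \<le> int (card (\<phi> ` X)))"

lemma feasible_pos:
  assumes "demands U D" "feasible D f" "u \<in> U"
  shows "1 \<le> f u"
proof (rule ccontr)
  assume "\<not> 1 \<le> f u"
  then have "{v \<in> {u}. 0 < f v} = {}" by auto
  then have "rk f {u} = 0" using rk_le[of f "{u}" 0] by (simp only:) simp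
  then show False using feasibleD[OF assms(2) demandsD(5)[OF assms(1,3)]] by simp
qed

lemma contract_valid:
  assumes "demands U D" "valid D f X K"
  shows "demands (U - K) (contract K D)" "feasible (contract K D) (dec f X)"
proof -
  have *: "n - meets K Z \<le> int (rk (dec f X) (Z - K))" if "(Z, n) \<in> D" for Z n
    using validD[OF assms(2) that] by simp
  then show "feasible (contract K D) (dec f X)"
    unfolding feasible_def contract_def by auto
  show "demands (U - K) (contract K D)"
  proof (rule demands_contract[OF assms(1)])
    fix Z n assume Z: "(Z, n) \<in> D"
    have "rk (dec f X) (Z - K) \<le> card (Z - K)"
      by (rule rk_le_card) (use demandsD(3)[OF assms(1) Z] in auto)
    then show "n - meets K Z \<le> int (card (Z - K))" using *[OF Z] by linarith
  qed
qed

lemma dominates_extend: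
  assumes dem: "demands U D" and "dominates (contract K D) \<phi>" and \<sigma>: "\<sigma> \<notin> \<phi> ` (U - K)"
  shows "dominates D (\<lambda>u. if u \<in> K then \<sigma> else \<phi> u)"
  unfolding dominates_def
proof (intro allI impI)
  fix Z n assume Z: "(Z, n) \<in> D"
  let ?\<psi> = "\<lambda>u. if u \<in> K then \<sigma> else \<phi> u"
  have fin: "finite Z" by (rule demandsD(3)[OF dem Z])
  have *: "n - meets K Z \<le> int (card (\<phi> ` (Z - K)))"
    using assms(2) contractI[OF Z] by (auto simp: dominates_def)
  show "n \<le> int (card (?\<psi> ` Z))"
  proof (cases "Z \<inter> K = {}")
    case True
    then have "Z - K = Z" "?\<psi> ` Z = \<phi> ` Z" by (auto intro!: image_cong)
    then show ?thesis using * True by (simp add: meets_def)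
  next
    case False
    then have "?\<psi> ` Z = insert \<sigma> (\<phi> ` (Z - K))" by (auto simp: image_iff)
    moreover have "\<sigma> \<notin> \<phi> ` (Z - K)" using \<sigma> demandsD(2)[OF dem Z] by auto
    ultimately show ?thesis using * False fin by (simp add: meets_def)
  qed
qed

text \<open>For each colour in turn, the stable pair for the elements having it on their list yields its
  colour class; every other such element loses one list entry and one unit of deadline.\<close>

lemma list_colouring_of_deadlines:
  assumes "finite C" "demands U D1" "demands U D2" "feasible D1 f1" "feasible D2 f2"
    and "\<And>u. u \<in> U \<Longrightarrow> L u \<subseteq> C" "\<And>u. u \<in> U \<Longrightarrow> f1 u + f2 u \<le> card (L u) + 1"
  shows "\<exists>\<phi>. (\<forall>u\<in>U. \<phi> u \<in> L u) \<and> dominates D1 \<phi> \<and> dominates D2 \<phi>"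
  using assms
proof (induction C arbitrary: U D1 D2 f1 f2 L rule: finite_induct)
  case empty
  have "U = {}"
  proof (rule ccontr)
    assume "U \<noteq> {}"
    then obtain u where u: "u \<in> U" by auto
    then have "1 \<le> f1 u" "1 \<le> f2 u" using feasible_pos[OF empty.prems(1,3)] feasible_pos[OF empty.prems(2,4)] by auto
    then show False using empty.prems(5,6)[OF u] by auto
  qed
  have "dominates D \<phi>" if "demands U D" for D and \<phi> :: "'b \<Rightarrow> 'a"
    unfolding dominates_def
  proof (intro allI impI)
    fix X n assume "(X, n) \<in> D"
    then have "X = {}" "n \<le> int (card X)" using demandsD[OF that] \<open>U = {}\<close> by auto
    then show "n \<le> int (card (\<phi> ` X))" by simp
  qed
  then show ?case using empty.prems(1,2) \<open>U = {}\<close> by simp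
next
  case (insert \<sigma> C)
  define V where "V = {u \<in> U. \<sigma> \<in> L u}"
  have VU: "V \<subseteq> U" by (auto simp: V_def)
  obtain X1 X2 where X: "X1 \<union> X2 = V" and
    val: "valid D1 f1 X1 (X1 \<inter> X2)" "valid D2 f2 X2 (X1 \<inter> X2)"
    using stable_pair[OF insert.prems(1-4) VU] by (elim exE conjE)
  let ?K = "X1 \<inter> X2"
  have "\<exists>\<phi>. (\<forall>u\<in>U - ?K. \<phi> u \<in> L u - {\<sigma>}) \<and>
      dominates (contract ?K D1) \<phi> \<and> dominates (contract ?K D2) \<phi>"
  proof (rule insert.IH)
    show "demands (U - ?K) (contract ?K D1)" "feasible (contract ?K D1) (dec f1 X1)"
      using contract_valid[OF insert.prems(1) val(1)] .
    show "demands (U - ?K) (contract ?K D2)" "feasible (contract ?K D2) (dec f2 X2)"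
      using contract_valid[OF insert.prems(2) val(2)] .
    fix u assume u: "u \<in> U - ?K"
    show "L u - {\<sigma>} \<subseteq> C" using insert.prems(5)[of u] u by auto
    have pos: "1 \<le> f1 u" "1 \<le> f2 u"
      using feasible_pos[OF insert.prems(1,3)] feasible_pos[OF insert.prems(2,4)] u by auto
    have le: "f1 u + f2 u \<le> card (L u) + 1" using insert.prems(6) u by auto
    show "dec f1 X1 u + dec f2 X2 u \<le> card (L u - {\<sigma>}) + 1"
    proof (cases "\<sigma> \<in> L u")
      case True
      then have "u \<in> X1 \<union> X2" using X u by (auto simp: V_def)
      moreover have "finite (L u)"
        using insert.prems(5)[of u] u insert.hyps(1) finite_subset by auto
      then have "card (L u) = Suc (card (L u - {\<sigma>}))" using True by (rule card.remove)
      \<comment> \<open>Outside \<open>?K\<close>, \<open>u\<close> lies in exactly one of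
        \<open>X1\<close> and \<open>X2\<close>; positivity makes the truncated subtraction remove a
        full unit there.\<close>
      ultimately show ?thesis using le pos u by (auto simp: dec_def)
    next
      case False
      then show ?thesis using le by (auto simp: dec_def)
    qed
  qed
  then obtain \<phi> where \<phi>: "\<forall>u\<in>U - ?K. \<phi> u \<in> L u - {\<sigma>}"
    "dominates (contract ?K D1) \<phi>" "dominates (contract ?K D2) \<phi>" by blast
  then have new: "\<sigma> \<notin> \<phi> ` (U - ?K)" by auto
  let ?\<psi> = "\<lambda>u. if u \<in> ?K then \<sigma> else \<phi> u"
  have "\<forall>u\<in>U. ?\<psi> u \<in> L u" using \<phi>(1) X by (auto simp: V_def)
  moreover have "dominates D1 ?\<psi>" by (rule dominates_extend[OF insert.prems(1) \<phi>(2) new])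
  moreover have "dominates D2 ?\<psi>" by (rule dominates_extend[OF insert.prems(2) \<phi>(3) new])
  ultimately show ?case by (intro exI[of _ ?\<psi>] conjI)
qed

section \<open>Effective demands\<close>

definition effective :: "('a set \<times> int) set \<Rightarrow> 'a set \<Rightarrow> int \<Rightarrow> bool" where
  "effective D X n \<longleftrightarrow> (X, n) \<in> D \<and> 2 \<le> n \<and> (\<forall>Y m. (Y, m) \<in> D \<longrightarrow> Y \<subset> X \<longrightarrow> m < n)"

text \<open>Expresses that \<open>c\<close> is at most the effective demand at \<open>u\<close>
  without forming a maximum; \<open>c \<le> 1\<close> stands for the outer maximum with 1.\<close>

definition within :: "('a set \<times> int) set \<Rightarrow> 'a \<Rightarrow> nat \<Rightarrow> bool" where
  "within D u c \<longleftrightarrow> c \<le> 1 \<or> (\<exists>X n. effective D X n \<and> u \<in> X \<and> int c \<le> n)"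

lemma within_mono: "within D u c \<Longrightarrow> b \<le> c \<Longrightarrow> within D u b"
  unfolding within_def using order_trans[of "int b" "int c"] by fastforce

lemma effective_subset:
  assumes "demands U D" "(X, n) \<in> D" "2 \<le> n"
  obtains Y m where "effective D Y m" "Y \<subseteq> X" "n \<le> m"
proof -
  let ?S = "{Y. Y \<subseteq> X \<and> (\<exists>m. (Y, m) \<in> D \<and> n \<le> m)}"
  have "finite ?S" using demandsD(3)[OF assms(1,2)] by auto
  moreover have "X \<in> ?S" using assms by auto
  ultimately obtain Y where "Y \<in> ?S" and min: "\<forall>X\<in>?S. X \<subseteq> Y \<longrightarrow> Y = X"
    using finite_has_minimal[of ?S] by (metis (no_types, lifting) empty_iff)
  then obtain m where m: "(Y, m) \<in> D" "n \<le> m" "Y \<subseteq> X" by auto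
  have "m' < m" if m': "(Y', m') \<in> D" "Y' \<subset> Y" for Y' m'
  proof (rule ccontr)
    assume "\<not> m' < m"
    then have "Y' \<in> ?S" using m' m by fastforce
    then show False using min m'(2) by blast
  qed
  then have "effective D Y m" using m assms(3) by (auto simp: effective_def)
  then show ?thesis using m by (intro that[of Y m]) auto
qed

text \<open>An effective subset \<open>Y\<close> of the preimage loses no more than the preimage
  does, so \<open>Y - K\<close> cannot be a proper subset of \<open>X\<close>. The summand
  \<open>meets K Y\<close> later forces the maximum to drop where all top sets meet
  \<open>K\<close>.\<close>

lemma effective_contract:
  assumes "demands U D" "effective (contract K D) X v" "u \<in> X"
  obtains Y m where "effective D Y m" "u \<in> Y" "v + meets K Y \<le> m"
proof -
  obtain X' n where X': "(X', n) \<in> D" "X = X' - K" "v = n - meets K X'"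
    using assms(2) unfolding effective_def contract_def by auto
  have "2 \<le> v" using assms(2) by (simp add: effective_def)
  then have "2 \<le> n" using X'(3) meets_bounds[of K X'] by linarith
  then obtain Y m where Y: "effective D Y m" "Y \<subseteq> X'" "n \<le> m"
    using effective_subset[OF assms(1) X'(1)] by blast
  have le: "v + meets K Y \<le> m"
    using Y X'(3) by (auto simp: meets_def split: if_splits)
  have "(Y - K, m - meets K Y) \<in> contract K D"
    using Y(1) by (intro contractI) (simp add: effective_def)
  then have "\<not> Y - K \<subset> X"
    using assms(2) le by (fastforce simp: effective_def)
  then have "u \<in> Y" using Y(2) X'(2) assms(3) by auto
  then show ?thesis using that Y(1) le by blast
qed

lemma within_contract:
  assumes "demands U D" "within (contract K D) u c"
  shows "within D u c"
proof (cases "c \<le> 1")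
  case False
  then obtain X v where X: "effective (contract K D) X v" "u \<in> X" "int c \<le> v"
    using assms(2) unfolding within_def by auto
  obtain Y m where Y: "effective D Y m" "u \<in> Y" "v + meets K Y \<le> m"
    using effective_contract[OF assms(1) X(1,2)] .
  then have "int c \<le> m" using X(3) meets_bounds[of K Y] by linarith
  then show ?thesis using Y unfolding within_def by auto
qed (simp add: within_def)

text \<open>Only level \<open>f u - 1\<close> is affected. A demand broken there was tight at that
  level; an effective subset of at least the same value has the same elements above the level, among
  them \<open>u\<close>, and bounds \<open>f u\<close>.\<close>

lemma feasible_lower:
  assumes dem: "demands U D" and feas: "feasible D f" and nw: "\<not> within D u (f u)"
  shows "feasible D (f(u := f u - 1))"
proof (rule ccontr)
  let ?h = "f(u := f u - 1)"
  assume "\<not> feasible D ?h"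
  then obtain X n where X: "(X, n) \<in> D" "\<not> n \<le> int (rk ?h X)"
    by (auto simp: feasible_def)
  then obtain j where j: "\<not> n \<le> int (j + card {v \<in> X. j < ?h v})"
    using le_rk_iff[of n ?h X] by blast
  have fX: "finite X" by (rule demandsD(3)[OF dem X(1)])
  have up: "m \<le> int (j + card {v \<in> Y. j < f v})" if "(Y, m) \<in> D" for Y m
    using feasibleD[OF feas that] le_rk_iff by blast
  have c: "2 \<le> f u" using nw by (auto simp: within_def)
  have u: "u \<in> X" "j = f u - 1"
  proof -
    have "{v \<in> X. j < f v} \<noteq> {v \<in> X. j < ?h v}"
    proof
      assume eq: "{v \<in> X. j < f v} = {v \<in> X. j < ?h v}"
      show False using j up[OF X(1)] unfolding eq by blast
    qed
    then have "\<not> (u \<notin> X \<or> j \<noteq> f u - 1)" by (auto split: if_splits)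
    then show "u \<in> X" "j = f u - 1" by auto
  qed
  have "{v \<in> X. j < f v} = insert u {v \<in> X. j < ?h v}" using u c by auto
  then have "card {v \<in> X. j < f v} = Suc (card {v \<in> X. j < ?h v})" using fX u by simp
  then have n: "n = int (j + card {v \<in> X. j < f v})" "int (f u) \<le> n"
    using j up[OF X(1)] u c by auto
  then have "2 \<le> n" using c by linarith
  then obtain Y m where Y: "effective D Y m" "Y \<subseteq> X" "n \<le> m"
    using effective_subset[OF dem X(1)] by blast
  then have "m \<le> int (j + card {v \<in> Y. j < f v})" by (intro up) (simp add: effective_def)
  then have "card {v \<in> X. j < f v} \<le> card {v \<in> Y. j < f v}" using n Y by linarith
  moreover have sub: "{v \<in> Y. j < f v} \<subseteq> {v \<in> X. j < f v}" using Y by auto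
  ultimately have "{v \<in> Y. j < f v} = {v \<in> X. j < f v}"
    using fX by (intro card_seteq) auto
  moreover have "u \<in> {v \<in> X. j < f v}" using u c by simp
  ultimately have "u \<in> Y" by blast
  moreover have "int (f u) \<le> m" using Y n by linarith
  ultimately have "within D u (f u)" using Y(1) unfolding within_def by blast
  then show False using nw by simp
qed

lemma feasible_compress:
  assumes "demands U D" "feasible D f"
  shows "\<exists>h. feasible D h \<and> (\<forall>u. h u \<le> f u) \<and> (\<forall>u\<in>U. within D u (h u))"
  using assms(2)
proof (induction "sum f U" arbitrary: f rule: less_induct)
  case less
  show ?case
  proof (cases "\<forall>u\<in>U. within D u (f u)")
    case True
    then show ?thesis using less.prems by (intro exI[of _ f]) auto
  next
    case False
    then obtain u where u: "u \<in> U" "\<not> within D u (f u)" by auto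
    let ?g = "f(u := f u - 1)"
    have "f u \<noteq> 0" using u(2) by (auto simp: within_def)
    then have smaller: "sum ?g U < sum f U"
      using u(1) demandsD(1)[OF assms(1)] by (intro sum_strict_mono_ex1) auto
    obtain h where h: "feasible D h" "\<forall>v. h v \<le> ?g v" "\<forall>v\<in>U. within D v (h v)"
      using less.hyps[OF smaller feasible_lower[OF assms(1) less.prems u(2)]] by (elim exE conjE)
    have "?g v \<le> f v" for v by simp
    then have "\<forall>v. h v \<le> f v" using h(2) le_trans by blast
    then show ?thesis using h by blast
  qed
qed

section \<open>Sets of maximum demand\<close>

text \<open>A set whose demand equals its size needs distinct colours throughout, so a contracted
  set must not contain two tied elements.\<close>

definition tied :: "('a set \<times> int) set \<Rightarrow> 'a \<Rightarrow> 'a \<Rightarrow> bool" where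
  "tied D s t \<longleftrightarrow> (\<exists>Z. (Z, int (card Z)) \<in> D \<and> s \<in> Z \<and> t \<in> Z)"

locale capped =
  fixes U :: "'a set" and D :: "('a set \<times> int) set" and k :: nat
  assumes dem: "demands U D" and k2: "2 \<le> k" and cap: "(X, n) \<in> D \<Longrightarrow> n \<le> int k"
begin

definition tops :: "'a set set" where
  "tops = {X. effective D X (int k)}"

lemma topsD:
  assumes "X \<in> tops"
  shows "(X, int k) \<in> D" "X \<subseteq> U" "finite X" "k \<le> card X"
    and "(Y, m) \<in> D \<Longrightarrow> Y \<subset> X \<Longrightarrow> m < int k"
proof -
  show 1: "(X, int k) \<in> D" using assms by (simp add: tops_def effective_def)
  show "X \<subseteq> U" "finite X" "k \<le> card X"
    using demandsD(2-4)[OF dem 1] by simp_all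
  show "(Y, m) \<in> D \<Longrightarrow> Y \<subset> X \<Longrightarrow> m < int k"
    using assms by (simp add: tops_def effective_def)
qed

text \<open>The union with \<open>X\<close> demands at most \<open>k\<close>, which \<open>X\<close>
  alone demands already, so supermodularity passes the whole demand of \<open>Z\<close> on to
  \<open>Z \<inter> X\<close>.\<close>

lemma restrict_to_top:
  assumes "X \<in> tops" "(Z, n) \<in> D" "Z \<inter> X \<noteq> {}"
  obtains A m where "(A, m) \<in> D" "n \<le> m" "A \<subseteq> X" "Z \<inter> X = A"
proof (cases "X \<subseteq> Z \<or> Z \<subseteq> X")
  case True
  then show ?thesis
  proof
    assume "X \<subseteq> Z"
    then show ?thesis using that[of X "int k"] topsD(1)[OF assms(1)] cap[OF assms(2)] by auto
  next
    assume "Z \<subseteq> X"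
    then show ?thesis using that[of Z n] assms(2) by auto
  qed
next
  case False
  then have "intersecting Z X" using assms(3) by (auto simp: intersecting_def)
  then obtain p q where pq: "(Z \<union> X, p) \<in> D" "(Z \<inter> X, q) \<in> D" "n + int k \<le> p + q"
    using demands_supermodular[OF dem assms(2) topsD(1)[OF assms(1)]] by blast
  then have "n \<le> q" using cap[OF pq(1)] by linarith
  then show ?thesis using that[OF pq(2)] by auto
qed

lemma tops_disjoint:
  assumes "X \<in> tops" "Y \<in> tops" "X \<noteq> Y"
  shows "X \<inter> Y = {}"
proof (rule ccontr)
  assume "X \<inter> Y \<noteq> {}"
  then obtain A m where A: "(A, m) \<in> D" "int k \<le> m" "A \<subseteq> Y" "X \<inter> Y = A"
    using restrict_to_top[OF assms(2) topsD(1)[OF assms(1)]] by blast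
  then have "\<not> A \<subset> X" "\<not> A \<subset> Y"
    using topsD(5)[OF assms(1) A(1)] topsD(5)[OF assms(2) A(1)] by auto
  then show False using A assms(3) by auto
qed

lemma tied_refl: "u \<in> U \<Longrightarrow> tied D u u"
  using demandsD(5)[OF dem, of u] unfolding tied_def by (intro exI[of _ "{u}"]) simp

lemma tied_sym: "tied D s t \<Longrightarrow> tied D t s"
  by (auto simp: tied_def)

lemma tight_Un:
  assumes Z: "(Z, int (card Z)) \<in> D" and Y: "(Y, int (card Y)) \<in> D" and "Z \<inter> Y \<noteq> {}"
  shows "(Z \<union> Y, int (card (Z \<union> Y))) \<in> D"
proof (cases "Z \<subseteq> Y \<or> Y \<subseteq> Z")
  case True
  then show ?thesis using Z Y by (auto simp: Un_absorb1 Un_absorb2)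
next
  case False
  then have "intersecting Z Y" using assms(3) by (auto simp: intersecting_def)
  then obtain p q where pq: "(Z \<union> Y, p) \<in> D" "(Z \<inter> Y, q) \<in> D"
    "int (card Z) + int (card Y) \<le> p + q"
    using demands_supermodular[OF dem Z Y] by blast
  have "card Z + card Y = card (Z \<union> Y) + card (Z \<inter> Y)"
    using demandsD(3)[OF dem] Z Y by (intro card_Un_Int) auto
  then have "p = int (card (Z \<union> Y))"
    using pq demandsD(4)[OF dem pq(1)] demandsD(4)[OF dem pq(2)] by linarith
  then show ?thesis using pq by simp
qed

lemma tied_trans:
  assumes "tied D r s" "tied D s t"
  shows "tied D r t"
proof -
  obtain Z Y where *: "(Z, int (card Z)) \<in> D" "r \<in> Z" "s \<in> Z"
    "(Y, int (card Y)) \<in> D" "s \<in> Y" "t \<in> Y"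
    using assms unfolding tied_def by blast
  then have "(Z \<union> Y, int (card (Z \<union> Y))) \<in> D" by (intro tight_Un) auto
  then show ?thesis using * unfolding tied_def by (intro exI[of _ "Z \<union> Y"]) auto
qed

text \<open>A maximal tight set through \<open>u\<close> absorbs every other one; its size is a
  demand, hence at most \<open>k\<close>.\<close>

lemma card_tied:
  assumes "u \<in> U"
  shows "finite {v. tied D u v}" "card {v. tied D u v} \<le> k"
proof -
  let ?T = "{Z. (Z, int (card Z)) \<in> D \<and> u \<in> Z}"
  have "finite ?T"
    by (rule finite_subset[of _ "Pow U"]) (use demandsD(1,2)[OF dem] in auto)
  moreover have "{u} \<in> ?T" using demandsD(5)[OF dem assms] by simp
  ultimately obtain Z where Z: "Z \<in> ?T" and max: "\<forall>Y\<in>?T. Z \<subseteq> Y \<longrightarrow> Z = Y"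
    using finite_has_maximal[of ?T] by (metis (no_types, lifting) empty_iff)
  have sub: "{v. tied D u v} \<subseteq> Z"
  proof
    fix v assume "v \<in> {v. tied D u v}"
    then obtain Y where Y: "(Y, int (card Y)) \<in> D" "u \<in> Y" "v \<in> Y"
      by (auto simp: tied_def)
    then have "Z \<union> Y \<in> ?T" using Z tight_Un[of Z Y] by auto
    then have "Z = Z \<union> Y" using max by blast
    then show "v \<in> Z" using Y by auto
  qed
  have fin: "finite Z" using Z demandsD(3)[OF dem] by blast
  then show "finite {v. tied D u v}" using sub finite_subset by blast
  have "card Z \<le> k" using Z cap[of Z "int (card Z)"] by auto
  then show "card {v. tied D u v} \<le> k" using card_mono[OF fin sub] by linarith
qed

text \<open>\<open>K\<close> has at most one element in each top set, except that \<open>u\<close>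
  may join one it is not tied to. Cut down to a top set, a demand set containing both is not tight,
  and this slack pays for the second deletion.\<close>

lemma contract_transversal:
  assumes "\<And>t. t \<in> K \<Longrightarrow> t \<noteq> u \<Longrightarrow> t \<in> \<Union>tops"
    and untied: "\<And>Y s t. Y \<in> tops \<Longrightarrow> s \<in> K \<inter> Y \<Longrightarrow> t \<in> K \<inter> Y \<Longrightarrow> s \<noteq> t \<Longrightarrow> s \<noteq> u \<Longrightarrow>
      t = u \<and> \<not> tied D s t"
    and Z: "(Z, n) \<in> D"
  shows "n - meets K Z \<le> int (card (Z - K))"
proof -
  have fZ: "finite Z" and nZ: "n \<le> int (card Z)" using demandsD(3,4)[OF dem Z] .
  consider "Z \<inter> K = {}" | "Z \<inter> K = {u}" | t where "t \<in> Z \<inter> K" "t \<noteq> u" by blast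
  then show ?thesis
  proof cases
    case 1
    then have "Z - K = Z" by auto
    then show ?thesis using 1 nZ by (simp add: meets_def)
  next
    case 2
    then have "Z - K = Z - {u}" "u \<in> Z" by auto
    then show ?thesis using 2 nZ fZ by (simp add: meets_def card_Diff_singleton)
  next
    case 3
    then obtain Y where Y: "Y \<in> tops" "t \<in> Y" using assms(1) by blast
    then have "Z \<inter> Y \<noteq> {}" using 3 by auto
    then obtain A m where A: "(A, m) \<in> D" "n \<le> m" "A \<subseteq> Y" "Z \<inter> Y = A"
      using restrict_to_top[OF Y(1) Z] by blast
    have fA: "finite A" using fZ A(4) by auto
    have tA: "t \<in> A" using 3 Y A by auto
    have mA: "m \<le> int (card A)" by (rule demandsD(4)[OF dem A(1)])
    have KA: "K \<inter> A \<subseteq> {t, u}" using untied[OF Y(1), of t] 3 Y A by blast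
    have "card (A - K) \<le> card (Z - K)" using fZ A(4) by (intro card_mono) auto
    moreover have "m - 1 \<le> int (card (A - K))"
    proof (cases "u \<in> K \<inter> A")
      case True
      then have "\<not> tied D t u" using untied[OF Y(1), of t u] 3 Y A by auto
      then have "m \<noteq> int (card A)" using A(1) tA True unfolding tied_def by blast
      moreover have "A - K = A - {t, u}" using KA 3 True by auto
      moreover have "card (A - {t, u}) = card A - 2" using 3 tA True fA by (subst card_Diff_subset) auto
      moreover have "card {t, u} \<le> card A" using tA True fA by (intro card_mono) auto
      ultimately show ?thesis using mA 3 by simp
    next
      case False
      then have "A - K = A - {t}" using KA 3 by auto
      then show ?thesis using mA tA fA by (simp add: card_Diff_singleton)
    qed
    moreover have "meets K Z = 1" using 3 by (auto simp: meets_def)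
    ultimately show ?thesis using A(2) by linarith
  qed
qed

end

section \<open>Alternating exchanges between two disjoint families\<close>

text \<open>For disjoint families these are matchings of a bipartite multigraph: its vertices are
  the members of \<open>E1\<close> and \<open>E2\<close>, its edges the elements covered by
  both.\<close>

definition matching :: "'a set set \<Rightarrow> 'a set set \<Rightarrow> 'a set \<Rightarrow> bool" where
  "matching E1 E2 N \<longleftrightarrow> finite N \<and> N \<subseteq> \<Union>E1 \<inter> \<Union>E2 \<and>
     (\<forall>X\<in>E1 \<union> E2. \<forall>s\<in>N \<inter> X. \<forall>t\<in>N \<inter> X. s = t)"

lemma matching_commute: "matching E2 E1 N \<longleftrightarrow> matching E1 E2 N"
  by (simp add: matching_def Un_commute Int_commute)

lemma matching_unique:
  "matching E1 E2 N \<Longrightarrow> X \<in> E1 \<or> X \<in> E2 \<Longrightarrow> s \<in> N \<Longrightarrow> t \<in> N \<Longrightarrow> s \<in> X \<Longrightarrow> t \<in> X \<Longrightarrow> s = t"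
  unfolding matching_def by blast

locale unmatched =
  fixes E1 E2 :: "'a set set" and X0 N :: "'a set"
  assumes disj1: "X \<in> E1 \<Longrightarrow> Y \<in> E1 \<Longrightarrow> v \<in> X \<Longrightarrow> v \<in> Y \<Longrightarrow> X = Y"
    and disj2: "X \<in> E2 \<Longrightarrow> Y \<in> E2 \<Longrightarrow> v \<in> X \<Longrightarrow> v \<in> Y \<Longrightarrow> X = Y"
    and N: "matching E1 E2 N"
    and max: "matching E1 E2 M \<Longrightarrow> card M \<le> card N"
    and X0: "X0 \<in> E1" "X0 \<inter> N = {}"
begin

text \<open>\<open>reach R X M\<close>: shifting \<open>N\<close> along an alternating path from \<open>X0\<close> to \<open>X\<close> gives the matching
  \<open>M\<close>, which misses \<open>X\<close>; an exchange of \<open>t\<close> for \<open>u\<close> requires \<open>R t u\<close>.\<close>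

inductive reach :: "('a \<Rightarrow> 'a \<Rightarrow> bool) \<Rightarrow> 'a set \<Rightarrow> 'a set \<Rightarrow> bool" for R where
  start: "reach R X0 N"
| shift: "reach R X M \<Longrightarrow> u \<in> X \<Longrightarrow> Y \<in> E2 \<Longrightarrow> u \<in> Y \<Longrightarrow> t \<in> M \<Longrightarrow> t \<in> Y \<Longrightarrow> R t u \<Longrightarrow>
    X' \<in> E1 \<Longrightarrow> t \<in> X' \<Longrightarrow> reach R X' (insert u (M - {t}))"

definition region :: "('a \<Rightarrow> 'a \<Rightarrow> bool) \<Rightarrow> 'a set set" where
  "region R = {X. \<exists>M. reach R X M}"

lemma reach_matching:
  assumes "reach R X M"
  shows "X \<in> E1" "X \<inter> M = {}" "matching E1 E2 M" "card M = card N"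
proof -
  have "X \<in> E1 \<and> X \<inter> M = {} \<and> matching E1 E2 M \<and> card M = card N"
    using assms
  proof induction
    case start
    then show ?case using X0 N by simp
  next
    case (shift X M u Y t X')
    then have X: "X \<in> E1" "X \<inter> M = {}" and M: "matching E1 E2 M" and cM: "card M = card N"
      by simp_all
    let ?M = "insert u (M - {t})"
    have uM: "u \<notin> M" using X shift.hyps by auto
    have finM: "finite M" using M by (simp add: matching_def)
    have "X' \<inter> ?M = {}"
    proof -
      have "u \<notin> X'" using disj1[OF X(1) shift.hyps(8), of u] X(2) shift.hyps by auto
      moreover have "s = t" if "s \<in> M" "s \<in> X'" for s
        using matching_unique[OF M _ that(1) shift.hyps(5) that(2) shift.hyps(9)] shift.hyps(8) by blast
      ultimately show ?thesis by auto
    qed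
    moreover have "matching E1 E2 ?M"
      unfolding matching_def
    proof (intro conjI ballI)
      show "finite ?M" using finM by simp
      have "M \<subseteq> \<Union>E1 \<inter> \<Union>E2" using M by (simp add: matching_def)
      then show "?M \<subseteq> \<Union>E1 \<inter> \<Union>E2" using X(1) shift.hyps by blast
      fix Z r s assume Z: "Z \<in> E1 \<union> E2" and rs: "r \<in> ?M \<inter> Z" "s \<in> ?M \<inter> Z"
      have other: "x \<notin> Z" if "u \<in> Z" "x \<in> M - {t}" for x
        using Z
      proof
        assume "Z \<in> E1"
        then have "Z = X" using disj1 X(1) that shift.hyps by blast
        then show ?thesis using X(2) that by auto
      next
        assume "Z \<in> E2"
        then have "Z = Y" using disj2 that shift.hyps by blast
        then show ?thesis
          using matching_unique[OF M, of Y x t] that shift.hyps by auto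
      qed
      show "r = s"
      proof (cases "u \<in> Z")
        case True
        then show ?thesis using other rs by auto
      next
        case False
        then have "r \<in> M" "s \<in> M" using rs by auto
        then show ?thesis using matching_unique[OF M, of Z r s] Z rs by auto
      qed
    qed
    moreover have "card ?M = card M"
      using uM finM card.remove[OF finM shift.hyps(5)] by simp
    ultimately show ?case using shift.hyps cM by simp
  qed
  then show "X \<in> E1" "X \<inter> M = {}" "matching E1 E2 M" "card M = card N" by simp_all
qed

lemma reach_disj:
  assumes "reach R X M" "u \<in> X" "u \<in> Y" "Y \<in> E2" "t \<in> M" "t \<in> Y" "Z \<in> E2" "Z \<noteq> Y"
  shows "Z \<inter> insert u (M - {t}) = Z \<inter> M"
  using disj2[OF assms(7,4)] assms by auto

lemma reach_hits1:
  assumes "reach R X M"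
  shows "X = X0 \<or> X \<inter> N \<noteq> {}"
    and "X' \<in> E1 \<Longrightarrow> X' \<noteq> X \<Longrightarrow> X' \<inter> M \<noteq> {} \<longleftrightarrow> X' = X0 \<or> X' \<inter> N \<noteq> {}"
proof -
  have "(X = X0 \<or> X \<inter> N \<noteq> {}) \<and>
    (\<forall>X'\<in>E1. X' \<noteq> X \<longrightarrow> (X' \<inter> M \<noteq> {} \<longleftrightarrow> X' = X0 \<or> X' \<inter> N \<noteq> {}))"
    using assms
  proof induction
    case start
    then show ?case by auto
  next
    case (shift X M u Y t X')
    note X = reach_matching[OF shift.hyps(1)]
    have ne: "X' \<noteq> X" using X(2) shift.hyps by auto
    have "X' \<inter> M \<noteq> {}" using shift.hyps by auto
    then have 1: "X' = X0 \<or> X' \<inter> N \<noteq> {}" using shift.IH ne shift.hyps(8) by auto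
    have "Z \<inter> insert u (M - {t}) \<noteq> {} \<longleftrightarrow> Z = X0 \<or> Z \<inter> N \<noteq> {}"
      if Z: "Z \<in> E1" "Z \<noteq> X'" for Z
    proof (cases "Z = X")
      case True
      then show ?thesis using shift.IH shift.hyps by auto
    next
      case False
      have "t \<notin> Z" using disj1[OF Z(1) shift.hyps(8)] Z(2) shift.hyps(9) by blast
      moreover have "u \<notin> Z" using disj1[OF Z(1) X(1)] False shift.hyps(2) by blast
      ultimately have "Z \<inter> insert u (M - {t}) = Z \<inter> M" by auto
      then show ?thesis using shift.IH Z False by auto
    qed
    then show ?case using 1 by blast
  qed
  then show "X = X0 \<or> X \<inter> N \<noteq> {}"
    "X' \<in> E1 \<Longrightarrow> X' \<noteq> X \<Longrightarrow> X' \<inter> M \<noteq> {} \<longleftrightarrow> X' = X0 \<or> X' \<inter> N \<noteq> {}" by blast+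
qed

lemma reach_hits2:
  assumes "reach R X M" "Z \<in> E2"
  shows "Z \<inter> M \<noteq> {} \<longleftrightarrow> Z \<inter> N \<noteq> {}"
  using assms
proof induction
  case (shift X M u Y t X')
  then show ?case
    using reach_disj[OF shift.hyps(1,2,4,3,5,6), of Z] by (cases "Z = Y") auto
qed simp

text \<open>Each exchange takes place inside one member of \<open>E2\<close>, so the exchanges made
  within \<open>Z\<close> compose by transitivity.\<close>

lemma reach_related:
  assumes "reach R X M" "Z \<in> E2" "s \<in> Z \<inter> N" "t \<in> Z \<inter> M"
    and refl: "\<And>s. s \<in> N \<Longrightarrow> R s s" and trans: "\<And>r s t. R r s \<Longrightarrow> R s t \<Longrightarrow> R r t"
  shows "R s t"
  using assms(1-4)
proof (induction arbitrary: t)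
  case start
  then have "s = t" using matching_unique[OF N, of Z s t] by auto
  then show ?case using refl start by auto
next
  case (shift X M u Y t' X')
  show ?case
  proof (cases "Z = Y")
    case True
    have "t = t' \<or> t = u" if "t \<in> insert u M"
      using matching_unique[OF reach_matching(3)[OF shift.hyps(1)], of Z t t'] that shift True by auto
    then have "t = u" using shift.prems by auto
    moreover have "R s t'" using shift True by auto
    ultimately show ?thesis using trans shift.hyps(7) by blast
  next
    case False
    then show ?thesis
      using reach_disj[OF shift.hyps(1,2,4,3,5,6) shift.prems(1)] shift by blast
  qed
qed

lemma reach_outside:
  assumes "reach R X M"
  shows "M - \<Union>(region R) = N - \<Union>(region R)"
  using assms
proof induction
  case (shift X M u Y t X')
  have "X \<in> region R" using shift.hyps(1) by (auto simp: region_def)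
  moreover have "X' \<in> region R"
    using reach.shift[OF shift.hyps] by (auto simp: region_def)
  ultimately have "u \<in> \<Union>(region R)" "t \<in> \<Union>(region R)" using shift.hyps by blast+
  then show ?case using shift.IH by blast
qed simp

text \<open>Otherwise adding \<open>v\<close> would augment \<open>M\<close>, against the maximality
  of \<open>N\<close>.\<close>

lemma reach_saturated:
  assumes "reach R X M" "v \<in> X" "Y \<in> E2" "v \<in> Y"
  shows "Y \<inter> M \<noteq> {}"
proof
  assume empty: "Y \<inter> M = {}"
  note X = reach_matching[OF assms(1)]
  have "v \<notin> M" using X(2) assms(2) by auto
  have "matching E1 E2 (insert v M)"
    unfolding matching_def
  proof (intro conjI ballI)
    show "finite (insert v M)" using X(3) by (simp add: matching_def)
    have "M \<subseteq> \<Union>E1 \<inter> \<Union>E2" using X(3) by (simp add: matching_def)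
    then show "insert v M \<subseteq> \<Union>E1 \<inter> \<Union>E2" using X(1) assms by blast
    fix Z r s assume Z: "Z \<in> E1 \<union> E2" and rs: "r \<in> insert v M \<inter> Z" "s \<in> insert v M \<inter> Z"
    have other: "Z \<inter> M = {}" if "v \<in> Z"
      using Z
    proof
      assume "Z \<in> E1"
      then have "Z = X" using disj1 X(1) that assms by blast
      then show ?thesis using X(2) by auto
    next
      assume "Z \<in> E2"
      then have "Z = Y" using disj2 that assms by blast
      then show ?thesis using empty by auto
    qed
    show "r = s"
    proof (cases "v \<in> Z")
      case True
      then show ?thesis using other rs by auto
    next
      case False
      then have "r \<in> M" "s \<in> M" using rs by auto
      then show ?thesis using matching_unique[OF X(3), of Z r s] Z rs by auto
    qed
  qed
  then have "card (insert v M) \<le> card N" by (rule max)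
  moreover have "finite M" using X(3) by (simp add: matching_def)
  ultimately show False using \<open>v \<notin> M\<close> X(4) by simp
qed

lemma reach_any: "reach R X M \<Longrightarrow> reach (\<lambda>_ _. True) X M"
  by (induction rule: reach.induct) (auto intro: reach.intros)

lemma region_subset: "region R \<subseteq> E1"
  using reach_matching(1) by (auto simp: region_def)

lemma X0_region: "X0 \<in> region R"
  using start by (auto simp: region_def)

lemma region_hit:
  assumes "reach R X M" "X' \<in> region S" "X' \<noteq> X"
  shows "X' \<inter> M \<noteq> {}"
proof -
  have "X' \<in> E1" using region_subset assms(2) by blast
  moreover have "X' = X0 \<or> X' \<inter> N \<noteq> {}"
    using assms(2) reach_hits1(1) unfolding region_def by blast
  ultimately show ?thesis using reach_hits1(2)[OF assms(1)] assms(3) by blast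
qed

text \<open>The element \<open>t\<close> of \<open>Y\<close> matched on a path to \<open>v\<close>
  can be shifted out, so it lies in the region. Outside the region all shifted matchings agree, so
  an element of \<open>M\<close> in \<open>Y\<close> lying there would have to be
  \<open>t\<close>.\<close>

lemma region_rep:
  assumes M: "reach (\<lambda>_ _. True) X M" and Y: "Y \<in> E2"
    and v: "v \<in> Y" "v \<in> \<Union>(region (\<lambda>_ _. True))"
  shows "Y \<inter> M \<inter> \<Union>(region (\<lambda>_ _. True)) \<noteq> {}"
proof -
  let ?R = "\<lambda>_ _ :: 'a. True"
  obtain X' M' where M': "reach ?R X' M'" "v \<in> X'"
    using v(2) unfolding region_def by blast
  then have "Y \<inter> M' \<noteq> {}" using reach_saturated Y v(1) by blast
  then obtain t where t: "t \<in> Y" "t \<in> M'" by auto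
  have "t \<in> \<Union>E1" using reach_matching(3)[OF M'(1)] t(2) by (auto simp: matching_def)
  then obtain X'' where X'': "X'' \<in> E1" "t \<in> X''" by auto
  have "reach ?R X'' (insert v (M' - {t}))"
    using reach.shift[OF M' Y v(1) t(2,1) TrueI X''] .
  then have tW: "t \<in> \<Union>(region ?R)" using X'' by (auto simp: region_def)
  have "Y \<inter> M \<noteq> {}" using \<open>Y \<inter> M' \<noteq> {}\<close> reach_hits2[OF M Y] reach_hits2[OF M'(1) Y] by simp
  then obtain s where s: "s \<in> Y" "s \<in> M" by auto
  have "s \<in> \<Union>(region ?R)"
  proof (rule ccontr)
    assume ns: "s \<notin> \<Union>(region ?R)"
    then have "s \<in> M'" using reach_outside[OF M] reach_outside[OF M'(1)] s by blast
    then have "s = t" using matching_unique[OF reach_matching(3)[OF M'(1)], of Y s t] Y s t by auto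
    then show False using ns tW by simp
  qed
  then show ?thesis using s by auto
qed

text \<open>If every exchange stayed inside classes of size at most \<open>k\<close>, the classes of the matched
  elements of the region would cover it, contradicting that one member of the region is unmatched.\<close>

lemma escape:
  assumes refl: "\<And>s. s \<in> N \<Longrightarrow> R s s" and trans: "\<And>r s t. R r s \<Longrightarrow> R s t \<Longrightarrow> R r t"
    and small: "\<And>s. s \<in> N \<Longrightarrow> finite {v. R s v} \<and> card {v. R s v} \<le> k"
    and large: "\<And>X. X \<in> E1 \<Longrightarrow> finite X \<and> k \<le> card X" and k: "0 < k" and E1: "finite E1"
  shows "\<exists>X M u. reach R X M \<and> u \<in> X \<and> (\<forall>Y\<in>E2. \<forall>t\<in>Y \<inter> M. u \<in> Y \<longrightarrow> \<not> R t u)"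
proof (rule ccontr)
  assume "\<not> ?thesis"
  then have stuck: "\<exists>Y t. Y \<in> E2 \<and> u \<in> Y \<and> t \<in> Y \<and> t \<in> M \<and> R t u" if "reach R X M" "u \<in> X" for X M u
    using that by blast
  let ?W = "\<Union>(region R)"
  have finA: "finite (region R)" using region_subset E1 finite_subset by blast
  have finN: "finite N" using N by (simp add: matching_def)
  have cover: "?W \<subseteq> (\<Union>s\<in>N \<inter> ?W. {v. R s v})"
  proof
    fix u assume "u \<in> ?W"
    then obtain X M where X: "reach R X M" "u \<in> X" by (auto simp: region_def)
    then obtain Y t where Y: "Y \<in> E2" "u \<in> Y" "t \<in> Y" "t \<in> M" "R t u" using stuck by blast
    have "t \<in> \<Union>E1" using reach_matching(3)[OF X(1)] Y(4) by (auto simp: matching_def)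
    then obtain X' where X': "X' \<in> E1" "t \<in> X'" by auto
    have "reach R X' (insert u (M - {t}))"
      using reach.shift[OF X Y(1,2,4,3,5) X'] .
    then have tW: "t \<in> ?W" using X' by (auto simp: region_def)
    \<comment> \<open>The covering classes are indexed by \<open>N\<close> rather than by the
      shifted matchings, which keeps their number below that of the sets in the region.\<close>
    have "Y \<inter> N \<noteq> {}" using reach_hits2[OF X(1) Y(1)] Y by auto
    then obtain s where s: "s \<in> Y" "s \<in> N" by auto
    have "s \<in> ?W"
    proof (rule ccontr)
      assume "s \<notin> ?W"
      then have "s \<in> M" using reach_outside[OF X(1)] s(2) by blast
      then have "s = t" using matching_unique[OF reach_matching(3)[OF X(1)], of Y s t] Y s by auto
      then show False using tW \<open>s \<notin> ?W\<close> by simp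
    qed
    moreover have "R s t" using reach_related[OF X(1) Y(1), of s t] s Y refl trans by blast
    then have "R s u" using trans Y(5) by blast
    ultimately show "u \<in> (\<Union>s\<in>N \<inter> ?W. {v. R s v})" using s by auto
  qed
  have "card ?W \<le> card (\<Union>s\<in>N \<inter> ?W. {v. R s v})"
    using cover small finN by (intro card_mono) auto
  also have "\<dots> \<le> (\<Sum>s\<in>N \<inter> ?W. card {v. R s v})" using finN by (intro card_UN_le) auto
  also have "\<dots> \<le> (\<Sum>s\<in>N \<inter> ?W. k)" using small by (intro sum_mono) auto
  finally have upper: "card ?W \<le> k * card (N \<inter> ?W)" by (simp add: mult.commute)
  have "N \<inter> ?W = (\<Union>X\<in>region R - {X0}. N \<inter> X)" using X0(2) by auto
  then have "card (N \<inter> ?W) \<le> (\<Sum>X\<in>region R - {X0}. card (N \<inter> X))"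
    using finA by (simp only:) (intro card_UN_le, auto)
  also have "\<dots> \<le> (\<Sum>X\<in>region R - {X0}. 1)"
  proof (rule sum_mono)
    fix X assume "X \<in> region R - {X0}"
    then have "X \<in> E1" using region_subset by auto
    then have "\<forall>s\<in>N \<inter> X. \<forall>t\<in>N \<inter> X. s = t" using matching_unique[OF N] by blast
    then show "card (N \<inter> X) \<le> 1" using finN by (simp add: card_le_Suc0_iff_eq)
  qed
  finally have "card (N \<inter> ?W) < card (region R)"
    using X0_region[of R] finA card_gt_0_iff[of "region R"] by (auto simp: card_Diff_singleton)
  then have "card ?W < k * card (region R)"
    using upper k by (meson le_less_trans mult_less_mono2)
  moreover have "card ?W = (\<Sum>X\<in>region R. card X)"
  proof (rule card_Union_disjoint)
    show "pairwise disjnt (region R)"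
      unfolding pairwise_def disjnt_iff using disj1 region_subset by blast
    show "\<And>X. X \<in> region R \<Longrightarrow> finite X" using large region_subset by blast
  qed
  moreover have "(\<Sum>X\<in>region R. k) \<le> (\<Sum>X\<in>region R. card X)"
    using large region_subset by (intro sum_mono) auto
  ultimately show False by (simp add: mult.commute)
qed

end

section \<open>Deadlines for both sides\<close>

text \<open>\<open>K\<close> will be put first on the side of \<open>D1\<close> and last on the side of \<open>D2\<close>; only elements of
  \<open>\<Union>A\<close> are postponed by it on the first side.\<close>

definition good :: "nat \<Rightarrow> ('a set \<times> int) set \<Rightarrow> ('a set \<times> int) set \<Rightarrow> 'a set set \<Rightarrow> 'a set \<Rightarrow> bool" where
  "good k D1 D2 A K \<longleftrightarrow> A \<noteq> {} \<and> K \<subseteq> \<Union>A \<and>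
     (\<forall>X\<in>A. effective D1 X (int k) \<and> X \<inter> K \<noteq> {}) \<and>
     (\<forall>Y. effective D2 Y (int k) \<longrightarrow> Y \<inter> \<Union>A \<noteq> {} \<longrightarrow> Y \<inter> K \<noteq> {}) \<and>
     (\<forall>Z n. (Z, n) \<in> D1 \<union> D2 \<longrightarrow> n - meets K Z \<le> int (card (Z - K)))"

text \<open>Within the region \<open>M\<close> misses only \<open>X\<close>, so
  \<open>u \<in> X\<close> completes it on the side of \<open>D1\<close>. On the other side
  \<open>u\<close> may share a top set with an element of \<open>M\<close>, but one it is not tied
  to.\<close>

lemma good_if_unmatched:
  assumes "capped U D1 k" "capped U D2 k"
    and N: "matching (capped.tops D1 k) (capped.tops D2 k) N"
    and max: "\<And>M. matching (capped.tops D1 k) (capped.tops D2 k) M \<Longrightarrow> card M \<le> card N"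
    and X0: "X0 \<in> capped.tops D1 k" "X0 \<inter> N = {}"
  shows "\<exists>A K. good k D1 D2 A K"
proof -
  interpret c1: capped U D1 k by fact
  interpret c2: capped U D2 k by fact
  interpret unmatched c1.tops c2.tops X0 N
  proof
    show "X = Y" if "X \<in> c1.tops" "Y \<in> c1.tops" "v \<in> X" "v \<in> Y" for X Y v
      using c1.tops_disjoint[OF that(1,2)] that(3,4) by auto
    show "X = Y" if "X \<in> c2.tops" "Y \<in> c2.tops" "v \<in> X" "v \<in> Y" for X Y v
      using c2.tops_disjoint[OF that(1,2)] that(3,4) by auto
  qed (use assms in auto)
  have NU: "s \<in> U" if "s \<in> N" for s
    using N that c1.topsD(2) by (fastforce simp: matching_def)
  have "finite c1.tops"
    by (rule finite_subset[of _ "Pow U"]) (use c1.topsD(2) demandsD(1)[OF c1.dem] in auto)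
  then have "\<exists>X M u. reach (tied D2) X M \<and> u \<in> X \<and>
      (\<forall>Y\<in>c2.tops. \<forall>t\<in>Y \<inter> M. u \<in> Y \<longrightarrow> \<not> tied D2 t u)"
    using c2.tied_refl c2.card_tied NU c1.topsD(3,4) c1.k2 c2.tied_trans
    by (intro escape[of _ k]) auto
  then obtain X M u where X: "reach (tied D2) X M" "u \<in> X"
    and u: "\<forall>Y\<in>c2.tops. \<forall>t\<in>Y \<inter> M. u \<in> Y \<longrightarrow> \<not> tied D2 t u"
    by (elim exE conjE)
  \<comment> \<open>The count behind \<open>u\<close> needs exchanges between tied elements, whereas
    hitting every top set of \<open>D2\<close> that meets the region needs the region of
    unrestricted exchanges.\<close>
  let ?R = "\<lambda>_ _ :: 'a. True"
  let ?W = "\<Union>(region ?R)"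
  let ?K = "insert u M \<inter> ?W"
  have X': "reach ?R X M" by (rule reach_any[OF X(1)])
  note XM = reach_matching[OF X(1)]
  have sub: "M \<subseteq> \<Union>c2.tops" using XM(3) by (auto simp: matching_def)
  have XR: "X \<in> region ?R" using X' unfolding region_def by blast
  have hit1: "Z \<inter> ?K \<noteq> {}" if Z: "Z \<in> region ?R" for Z
  proof (cases "Z = X")
    case True
    then show ?thesis using X(2) Z by blast
  next
    case False
    then have "Z \<inter> M \<noteq> {}" by (rule region_hit[OF X' Z])
    then show ?thesis using Z by blast
  qed
  have hit2: "Y \<inter> ?K \<noteq> {}" if Y: "Y \<in> c2.tops" "Y \<inter> ?W \<noteq> {}" for Y
  proof -
    obtain v where "v \<in> Y" "v \<in> ?W" using Y(2) by blast
    from region_rep[OF X' Y(1) this] show ?thesis by blast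
  qed
  have K1: "n - meets ?K Z \<le> int (card (Z - ?K))" if "(Z, n) \<in> D1" for Z n
  proof (rule c1.contract_transversal[OF _ _ that])
    show "t \<in> \<Union>c1.tops" if "t \<in> ?K" "t \<noteq> u" for t
      using that region_subset by blast
    fix Y s t assume Y: "Y \<in> c1.tops" "s \<in> ?K \<inter> Y" "t \<in> ?K \<inter> Y" "s \<noteq> t" "s \<noteq> u"
    then have "s \<in> M" by auto
    have False
    proof (cases "t = u")
      case True
      then have "Y = X" using disj1[OF Y(1) XM(1)] Y(3) X(2) by blast
      then show False using XM(2) \<open>s \<in> M\<close> Y(2) by blast
    next
      case False
      then show False using matching_unique[OF XM(3), of Y s t] Y by auto
    qed
    then show "t = u \<and> \<not> tied D1 s t" ..
  qed
  have K2: "n - meets ?K Z \<le> int (card (Z - ?K))" if "(Z, n) \<in> D2" for Z n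
  proof (rule c2.contract_transversal[OF _ _ that])
    show "t \<in> \<Union>c2.tops" if "t \<in> ?K" "t \<noteq> u" for t
      using that sub by blast
    fix Y s t assume Y: "Y \<in> c2.tops" "s \<in> ?K \<inter> Y" "t \<in> ?K \<inter> Y" "s \<noteq> t" "s \<noteq> u"
    then have "s \<in> M" by auto
    moreover have "t = u"
    proof (rule ccontr)
      assume "t \<noteq> u"
      then show False using matching_unique[OF XM(3), of Y s t] Y by auto
    qed
    ultimately show "t = u \<and> \<not> tied D2 s t" using u Y by blast
  qed
  have "effective D1 Z (int k)" if "Z \<in> region ?R" for Z
    using region_subset that by (auto simp: c1.tops_def)
  then have "good k D1 D2 (region ?R) ?K"
    unfolding good_def using XR hit1 hit2 K1 K2 by (auto simp: c2.tops_def)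
  then show ?thesis by blast
qed

lemma good_exists:
  assumes c: "capped U D1 k" "capped U D2 k"
    and ex: "capped.tops D1 k \<union> capped.tops D2 k \<noteq> {}"
  shows "\<exists>A K. good k D1 D2 A K \<or> good k D2 D1 A K"
proof -
  interpret c1: capped U D1 k by fact
  interpret c2: capped U D2 k by fact
  let ?m = "matching c1.tops c2.tops"
  have "card M \<le> card U" if "?m M" for M
  proof (rule card_mono)
    show "finite U" by (rule demandsD(1)[OF c1.dem])
    show "M \<subseteq> U" using that c1.topsD(2) by (fastforce simp: matching_def)
  qed
  then have "\<forall>M. ?m M \<longrightarrow> card M < Suc (card U)" by (simp add: le_imp_less_Suc)
  moreover have "?m {}" by (simp add: matching_def)
  ultimately obtain N where N: "?m N" "\<forall>M. ?m M \<longrightarrow> card M \<le> card N"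
    using ex_has_greatest_nat[of ?m "{}" card "Suc (card U)"] by blast
  show ?thesis
  proof (cases "\<exists>X\<in>c1.tops \<union> c2.tops. X \<inter> N = {}")
    case True
    then obtain X where X: "X \<in> c1.tops \<or> X \<in> c2.tops" "X \<inter> N = {}" by auto
    from X(1) show ?thesis
    proof
      assume "X \<in> c1.tops"
      then have "\<exists>A K. good k D1 D2 A K"
        using good_if_unmatched[OF c N(1)] N(2) X(2) by blast
      then show ?thesis by blast
    next
      assume "X \<in> c2.tops"
      moreover have "matching c2.tops c1.tops N" using N(1) matching_commute by blast
      moreover have "card M \<le> card N" if "matching c2.tops c1.tops M" for M
        using N(2) that matching_commute by blast
      ultimately have "\<exists>A K. good k D2 D1 A K"
        using good_if_unmatched[OF c(2,1)] X(2) by blast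
      then show ?thesis by blast
    qed
  next
    case False
    have sub: "N \<subseteq> \<Union>c1.tops" "N \<subseteq> \<Union>c2.tops" using N(1) by (auto simp: matching_def)
    then have "c1.tops \<noteq> {}" using ex False by auto
    have "n - meets N Z \<le> int (card (Z - N))" if "(Z, n) \<in> D1" for Z n
    proof (rule c1.contract_transversal[OF _ _ that])
      show "t \<in> \<Union>c1.tops" if "t \<in> N" for t using that sub by blast
      \<comment> \<open>A full matching has no exceptional element: \<open>undefined\<close> is a
        dummy for \<open>u\<close>, and the premises contradict
        \<open>matching_unique\<close>.\<close>
      show "t = undefined \<and> \<not> tied D1 s t"
        if "Y \<in> c1.tops" "s \<in> N \<inter> Y" "t \<in> N \<inter> Y" "s \<noteq> t" for Y s t
        using matching_unique[OF N(1), of Y s t] that by auto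
    qed
    moreover have "n - meets N Z \<le> int (card (Z - N))" if "(Z, n) \<in> D2" for Z n
    proof (rule c2.contract_transversal[OF _ _ that])
      show "t \<in> \<Union>c2.tops" if "t \<in> N" for t using that sub by blast
      show "t = undefined \<and> \<not> tied D2 s t"
        if "Y \<in> c2.tops" "s \<in> N \<inter> Y" "t \<in> N \<inter> Y" "s \<noteq> t" for Y s t
        using matching_unique[OF N(1), of Y s t] that by auto
    qed
    ultimately have "good k D1 D2 c1.tops N"
      unfolding good_def using False sub \<open>c1.tops \<noteq> {}\<close>
      by (auto simp: c1.tops_def c2.tops_def)
    then show ?thesis by blast
  qed
qed

definition joint :: "'a set \<Rightarrow> ('a set \<times> int) set \<Rightarrow> ('a set \<times> int) set \<Rightarrow> ('a \<Rightarrow> nat) \<Rightarrow> ('a \<Rightarrow> nat) \<Rightarrow> bool" where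
  "joint U D1 D2 f1 f2 \<longleftrightarrow> feasible D1 f1 \<and> feasible D2 f2 \<and>
     (\<forall>u\<in>U. within D1 u (f1 u + f2 u - 1) \<or> within D2 u (f1 u + f2 u - 1))"

lemma joint_commute: "joint U D2 D1 f2 f1 \<longleftrightarrow> joint U D1 D2 f1 f2"
  unfolding joint_def by (auto simp: add.commute)

text \<open>On the first side \<open>K\<close> is scheduled before everything in the union of \<open>A\<close>; on the second side
  it is scheduled last, and the deadlines are then compressed.\<close>

lemma joint_step:
  assumes c: "capped U D1 k" "capped U D2 k" and good: "good k D1 D2 A K"
    and IH: "joint (U - K) (contract K D1) (contract K D2) f1 f2"
  shows "\<exists>f1 f2. joint U D1 D2 f1 f2"
proof -
  interpret c1: capped U D1 k by fact
  interpret c2: capped U D2 k by fact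
  let ?W = "\<Union>A"
  have KW: "K \<subseteq> ?W" using good by (simp add: good_def)
  have AD: "X \<in> c1.tops \<and> X \<inter> K \<noteq> {}" if "X \<in> A" for X
    using good that by (simp add: good_def c1.tops_def)
  have hit2: "Y \<inter> K \<noteq> {}" if "Y \<in> c2.tops" "Y \<inter> ?W \<noteq> {}" for Y
    using good that by (simp add: good_def c2.tops_def)
  have r1: "n - meets K Z \<le> int (rk f1 (Z - K))" if "(Z, n) \<in> D1" for Z n
    using IH contractI[OF that, of K] by (auto simp: joint_def feasible_def)
  have r2: "n - meets K Z \<le> int (rk f2 (Z - K))" if "(Z, n) \<in> D2" for Z n
    using IH contractI[OF that, of K] by (auto simp: joint_def feasible_def)
  define g1 where "g1 u = (if u \<in> K then 1 else if u \<in> ?W then Suc (f1 u) else f1 u)" for u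
  define g2 where "g2 u = (if u \<in> K then k else f2 u)" for u
  have "feasible D1 g1"
    unfolding feasible_def
  proof (intro allI impI)
    fix Z n assume Z: "(Z, n) \<in> D1"
    have fZ: "finite Z" by (rule demandsD(3)[OF c1.dem Z])
    have inside: "m \<le> int (rk g1 Y)" if Y: "(Y, m) \<in> D1" "Y \<subseteq> X" "X \<in> A" for Y m X
      unfolding le_rk_iff
    proof
      fix j
      have fY: "finite Y" by (rule demandsD(3)[OF c1.dem Y(1)])
      have pos: "0 < g1 u" if "u \<in> Y" for u using Y that by (auto simp: g1_def)
      \<comment> \<open>Level 0 is the cardinality bound; at higher levels the shift by one level
        supplies the unit credited by \<open>meets K Y\<close>.\<close>
      show "m \<le> int (j + card {u \<in> Y. j < g1 u})"
      proof (cases j)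
        case 0
        have "{u \<in> Y. 0 < g1 u} = Y" using pos by auto
        then show ?thesis using 0 demandsD(4)[OF c1.dem Y(1)] by simp
      next
        case (Suc i)
        have "m - meets K Y \<le> int (i + card {u \<in> Y - K. i < f1 u})"
          using r1[OF Y(1)] le_rk_iff by blast
        moreover have "card {u \<in> Y - K. i < f1 u} \<le> card {u \<in> Y. j < g1 u}"
          using fY Y Suc by (intro card_mono) (auto simp: g1_def)
        ultimately show ?thesis using meets_bounds[of K Y] Suc by linarith
      qed
    qed
    show "n \<le> int (rk g1 Z)"
    proof (cases "Z \<inter> ?W = {}")
      case True
      then have "Z - K = Z" "meets K Z = 0" using KW by (auto simp: meets_def)
      then have "n \<le> int (rk f1 Z)" using r1[OF Z] by simp
      moreover have "rk f1 Z \<le> rk g1 Z" using fZ True KW by (intro rk_mono) (auto simp: g1_def)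
      ultimately show ?thesis by linarith
    next
      case False
      then obtain X where X: "X \<in> A" "Z \<inter> X \<noteq> {}" by auto
      then obtain B m where B: "(B, m) \<in> D1" "n \<le> m" "B \<subseteq> X" "Z \<inter> X = B"
        using c1.restrict_to_top[OF _ Z] AD by blast
      then have "m \<le> int (rk g1 B)" using inside X(1) by blast
      moreover have "rk g1 B \<le> rk g1 Z" using fZ B(4) by (intro rk_mono) auto
      ultimately show ?thesis using B(2) by linarith
    qed
  qed
  moreover have "feasible D2 g2"
    unfolding feasible_def le_rk_iff
  proof (intro allI impI)
    fix Z n j assume Z: "(Z, n) \<in> D2"
    have fZ: "finite Z" by (rule demandsD(3)[OF c2.dem Z])
    show "n \<le> int (j + card {u \<in> Z. j < g2 u})"
    proof (cases "k \<le> j")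
      case True
      then show ?thesis using c2.cap[OF Z] by linarith
    next
      case False
      have "n - meets K Z \<le> int (j + card {u \<in> Z - K. j < f2 u})"
        using r2[OF Z] le_rk_iff by blast
      moreover have "int (card {u \<in> Z - K. j < f2 u}) + meets K Z \<le> int (card {u \<in> Z. j < g2 u})"
      proof -
        have eq: "{u \<in> Z. j < g2 u} = {u \<in> Z - K. j < f2 u} \<union> (Z \<inter> K)"
          using False by (auto simp: g2_def)
        have "card {u \<in> Z. j < g2 u} = card {u \<in> Z - K. j < f2 u} + card (Z \<inter> K)"
          unfolding eq using fZ by (intro card_Un_disjoint) auto
        moreover have "meets K Z \<le> int (card (Z \<inter> K))"
          using fZ card_gt_0_iff[of "Z \<inter> K"] by (auto simp: meets_def)
        ultimately show ?thesis by linarith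
      qed
      ultimately show ?thesis by linarith
    qed
  qed
  \<comment> \<open>On \<open>K\<close>, where \<open>g1\<close> is 1, the target is
    \<open>h2 u\<close> alone; compression brings the provisional deadline \<open>k\<close> down to
    the effective demand.\<close>
  then obtain h2 where h2: "feasible D2 h2" "\<forall>u. h2 u \<le> g2 u" "\<forall>u\<in>U. within D2 u (h2 u)"
    using feasible_compress[OF c2.dem] by blast
  \<comment> \<open>Every top set through \<open>u\<close>, on either side, meets \<open>K\<close>
    and loses a unit. This pays for the extra unit in \<open>g1 u\<close>.\<close>
  have low: "v < int k" if W: "u \<in> ?W" "u \<notin> K"
    and v: "effective (contract K D1) X v \<or> effective (contract K D2) X v" "u \<in> X" for u X v
  proof (rule ccontr)
    assume "\<not> v < int k"
    then have kv: "int k \<le> v" by simp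
    obtain X' where X': "X' \<in> A" "u \<in> X'" using W by auto
    from v(1) show False
    proof
      assume "effective (contract K D1) X v"
      then obtain Y m where Y: "effective D1 Y m" "u \<in> Y" "v + meets K Y \<le> m"
        using effective_contract[OF c1.dem _ v(2)] by blast
      then have "m \<le> int k" using c1.cap by (auto simp: effective_def)
      then have "m = int k" "meets K Y = 0" using kv Y(3) meets_bounds[of K Y] by linarith+
      then have "Y \<in> c1.tops" "Y \<inter> K = {}" using Y(1) by (auto simp: c1.tops_def meets_def split: if_splits)
      moreover have "Y = X'" using c1.tops_disjoint[of Y X'] AD[OF X'(1)] X'(2) Y(2) calculation by blast
      ultimately show False using AD[OF X'(1)] by auto
    next
      assume "effective (contract K D2) X v"
      then obtain Y m where Y: "effective D2 Y m" "u \<in> Y" "v + meets K Y \<le> m"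
        using effective_contract[OF c2.dem _ v(2)] by blast
      then have "m \<le> int k" using c2.cap by (auto simp: effective_def)
      then have "m = int k" "meets K Y = 0" using kv Y(3) meets_bounds[of K Y] by linarith+
      then have "Y \<in> c2.tops" "Y \<inter> K = {}" using Y(1) by (auto simp: c2.tops_def meets_def split: if_splits)
      then show False using hit2[of Y] Y(2) W(1) by blast
    qed
  qed
  have "within D1 u (g1 u + h2 u - 1) \<or> within D2 u (g1 u + h2 u - 1)" if u: "u \<in> U" for u
  proof (cases "u \<in> K")
    case True
    then show ?thesis using h2(3) u by (simp add: g1_def)
  next
    case False
    have h2u: "h2 u \<le> f2 u" using h2(2)[rule_format, of u] False by (simp add: g2_def)
    let ?c = "f1 u + f2 u - 1"
    have w: "within (contract K D1) u ?c \<or> within (contract K D2) u ?c"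
      using IH u False by (auto simp: joint_def)
    show ?thesis
    proof (cases "u \<in> ?W")
      case True
      then obtain X where X: "X \<in> A" "u \<in> X" by auto
      have "Suc ?c \<le> k"
      proof (cases "?c \<le> 1")
        case True
        then show ?thesis using c1.k2 by linarith
      next
        case c: False
        then obtain Y v where "effective (contract K D1) Y v \<or> effective (contract K D2) Y v"
          "u \<in> Y" "int ?c \<le> v" using w unfolding within_def by blast
        then have "int ?c < int k" using low[OF True False] by fastforce
        then show ?thesis by linarith
      qed
      then have "int (g1 u + h2 u - 1) \<le> int k" using h2u True False by (simp add: g1_def)
      moreover have "effective D1 X (int k)" using AD[OF X(1)] by (simp add: c1.tops_def)
      ultimately show ?thesis using X(2) unfolding within_def by blast
    next
      case nW: False
      have "within D1 u ?c \<or> within D2 u ?c"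
        using w within_contract[OF c1.dem] within_contract[OF c2.dem] by blast
      moreover have "g1 u + h2 u - 1 \<le> ?c" using h2u nW False by (simp add: g1_def)
      ultimately show ?thesis
        using within_mono[of D1 u ?c "g1 u + h2 u - 1"] within_mono[of D2 u ?c "g1 u + h2 u - 1"]
        by blast
    qed
  qed
  ultimately show ?thesis using h2(1) unfolding joint_def by blast
qed

lemma joint_deadlines:
  assumes "demands U D1" "demands U D2"
  shows "\<exists>f1 f2. joint U D1 D2 f1 f2"
  using assms
proof (induction "card U" arbitrary: U D1 D2 rule: less_induct)
  case less
  note fU = demandsD(1)[OF less.prems(1)]
  show ?case
  proof (cases "\<exists>X n. (X, n) \<in> D1 \<union> D2 \<and> 2 \<le> n")
    case False
    have "feasible D (\<lambda>_. 1)" if D: "demands U D" "D \<subseteq> D1 \<union> D2" for D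
      unfolding feasible_def le_rk_iff
    proof (intro allI impI)
      fix X n and j :: nat assume X: "(X, n) \<in> D"
      have "\<not> 2 \<le> n" using False X D(2) by blast
      then show "n \<le> int (j + card {u \<in> X. j < 1})"
        using demandsD(4)[OF D(1) X] by (cases j) auto
    qed
    then show ?thesis using less.prems by (intro exI[of _ "\<lambda>_. 1"]) (simp add: joint_def within_def)
  next
    case True
    let ?P = "\<lambda>n. 2 \<le> n \<and> (\<exists>X. (X, int n) \<in> D1 \<union> D2)"
    obtain X n where X: "(X, n) \<in> D1 \<union> D2" "2 \<le> n" using True by blast
    then have P: "?P (nat n)" by auto
    have bound: "n \<le> card U" if "?P n" for n
    proof -
      obtain Y where Y: "(Y, int n) \<in> D1 \<union> D2" using \<open>?P n\<close> by blast
      then have "Y \<subseteq> U \<and> int n \<le> int (card Y)"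
        using demandsD(2,4)[OF less.prems(1), of Y "int n"]
          demandsD(2,4)[OF less.prems(2), of Y "int n"] by blast
      then show "n \<le> card U" using card_mono[OF fU, of Y] by linarith
    qed
    \<comment> \<open>One \<open>k\<close> serves both sides; a side that does not attain it has no
      top sets.\<close>
    define k where "k = Greatest ?P"
    have k: "?P k" "\<forall>n. ?P n \<longrightarrow> n \<le> k"
      unfolding k_def
      using GreatestI_nat[of ?P, OF P bound] Greatest_le_nat[of ?P, OF _ bound] by auto
    have cap: "n \<le> int k" if "(X, n) \<in> D1 \<union> D2" for X n
    proof (cases "2 \<le> n")
      case True
      then have "?P (nat n)" using that by auto
      then show ?thesis using k(2) by (metis nat_le_iff)
    next
      case False
      then show ?thesis using k(1) by linarith
    qed
    have c: "capped U D1 k" "capped U D2 k"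
      using less.prems k(1) cap by (auto simp: capped_def)
    obtain X where X: "(X, int k) \<in> D1 \<union> D2" using k(1) by blast
    have "2 \<le> int k" using k(1) by linarith
    have top: "capped.tops D k \<noteq> {}"
      if D: "demands U D" "capped U D k" "(X, int k) \<in> D" for D
    proof -
      obtain Y m where Y: "effective D Y m" "int k \<le> m"
        using effective_subset[OF D(1,3) \<open>2 \<le> int k\<close>] by blast
      then have "m = int k" using capped.cap[OF D(2)] by (force simp: effective_def)
      then show ?thesis using Y(1) capped.tops_def[OF D(2)] by auto
    qed
    have ex: "capped.tops D1 k \<union> capped.tops D2 k \<noteq> {}"
      using X top[OF less.prems(1) c(1)] top[OF less.prems(2) c(2)] by blast
    have step: "\<exists>f1 f2. joint U E1 E2 f1 f2"
      if E: "demands U E1" "demands U E2" "capped U E1 k" "capped U E2 k" "good k E1 E2 A K"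
      for E1 E2 A K
    proof -
      have A: "A \<noteq> {}" "\<forall>X\<in>A. effective E1 X (int k) \<and> X \<inter> K \<noteq> {}"
        using E(5) by (simp_all add: good_def)
      then obtain X where X: "effective E1 X (int k)" "X \<inter> K \<noteq> {}" by blast
      then have "X \<subseteq> U" using demandsD(2)[OF E(1), of X "int k"] by (simp add: effective_def)
      then have "U \<inter> K \<noteq> {}" using X(2) by blast
      then have "card (U - K) < card U" using fU by (intro psubset_card_mono) auto
      moreover have "demands (U - K) (contract K E1)" "demands (U - K) (contract K E2)"
        using E(5) demands_contract[OF E(1), of K] demands_contract[OF E(2), of K]
        by (simp_all add: good_def)
      ultimately obtain f1 f2 where "joint (U - K) (contract K E1) (contract K E2) f1 f2"
        using less.hyps[of "U - K" "contract K E1" "contract K E2"] by blast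
      then show ?thesis by (rule joint_step[OF E(3-5)])
    qed
    obtain A K where "good k D1 D2 A K \<or> good k D2 D1 A K"
      using good_exists[OF c ex] by blast
    then show ?thesis
    proof
      assume "good k D1 D2 A K"
      then show ?thesis using step[OF less.prems c] by blast
    next
      assume "good k D2 D1 A K"
      then obtain f1 f2 where "joint U D2 D1 f1 f2"
        using step[OF less.prems(2,1) c(2,1)] by blast
      then show ?thesis using joint_commute by blast
    qed
  qed
qed

section \<open>Demand systems of requirement functions\<close>

definition demand_graph :: "'a set \<Rightarrow> 'a set set \<Rightarrow> ('a set \<Rightarrow> int) \<Rightarrow> ('a set \<times> int) set" where
  "demand_graph U F g = {(X, g X) | X. X \<in> F} \<union> {({u}, 1) | u. u \<in> U}"

lemma demands_demand_graph:
  assumes "finite U" "intersecting_supermodular U F g" "\<And>X. X \<in> F \<Longrightarrow> g X \<le> int (card X)"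
  shows "demands U (demand_graph U F g)"
  unfolding demands_def
proof (intro conjI allI impI ballI)
  have F: "F \<subseteq> Pow U" using assms(2)
    by (simp add: intersecting_supermodular_def intersecting_family_def)
  show "X \<subseteq> U" "n \<le> int (card X)" if "(X, n) \<in> demand_graph U F g" for X n
    using that F assms(3) by (auto simp: demand_graph_def)
  fix X m Y n
  assume *: "(X, m) \<in> demand_graph U F g" "(Y, n) \<in> demand_graph U F g" "intersecting X Y"
  \<comment> \<open>A singleton never belongs to an intersecting pair.\<close>
  then have "X \<in> F" "Y \<in> F" "m = g X" "n = g Y"
    by (auto simp: demand_graph_def intersecting_def)
  moreover from this have "X \<union> Y \<in> F" "X \<inter> Y \<in> F" "g X + g Y \<le> g (X \<union> Y) + g (X \<inter> Y)"
    using assms(2) *(3)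
    by (auto simp: intersecting_supermodular_def intersecting_family_def)
  ultimately show "\<exists>p q. (X \<union> Y, p) \<in> demand_graph U F g \<and> (X \<inter> Y, q) \<in> demand_graph U F g \<and>
      m + n \<le> p + q"
    by (intro exI[of _ "g (X \<union> Y)"] exI[of _ "g (X \<inter> Y)"]) (auto simp: demand_graph_def)
qed (use assms(1) in \<open>auto simp: demand_graph_def\<close>)

lemma within_eff_demand:
  assumes "finite F" "within (demand_graph U F g) u c"
  shows "c \<le> eff_demand F g u"
proof -
  let ?S = "insert 1 {g X |X. X \<in> effective_family F g \<and> u \<in> X}"
  have "finite ?S"
    using assms(1) by (auto simp: effective_family_def)
  moreover have "\<exists>x\<in>?S. int c \<le> x"
  proof (cases "c \<le> 1")
    case False
    then obtain X n where X: "effective (demand_graph U F g) X n" "u \<in> X" "int c \<le> n"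
      using assms(2) unfolding within_def by blast
    then have "X \<in> F" "n = g X" by (auto simp: effective_def demand_graph_def)
    moreover have "g Y < n" if "Y \<in> F" "Y \<subset> X" for Y
    proof -
      have "(Y, g Y) \<in> demand_graph U F g" using that(1) by (auto simp: demand_graph_def)
      then show ?thesis using X(1) that(2) unfolding effective_def by blast
    qed
    ultimately have "X \<in> effective_family F g"
      using X(1) by (fastforce simp: effective_family_def effective_def)
    then show ?thesis using X \<open>n = g X\<close> by auto
  qed auto
  ultimately have "int c \<le> Max ?S" using Max_ge order_trans by blast
  then show ?thesis unfolding eff_demand_def by linarith
qed

theorem mainTheorem1:
  fixes U :: "'a set"
    and F1 F2 :: "'a set set"
    and g1 g2 :: "'a set \<Rightarrow> int"
    and S :: "'c set"
    and L :: "'a \<Rightarrow> 'c set"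
  assumes "finite U"
    and "intersecting_supermodular U F1 g1"
    and "intersecting_supermodular U F2 g2"
    and "\<And>X. X \<in> F1 \<Longrightarrow> int (card X) \<ge> g1 X"
    and "\<And>X. X \<in> F2 \<Longrightarrow> int (card X) \<ge> g2 X"
    and "L \<in> U \<rightarrow> Pow S"
    and "\<And>u. u \<in> U \<Longrightarrow> card (L u) = max (eff_demand F1 g1 u) (eff_demand F2 g2 u)"
  shows "\<exists>\<phi>. list_supermodular_coloring U F1 g1 F2 g2 S L \<phi>"
proof -
  let ?D1 = "demand_graph U F1 g1" and ?D2 = "demand_graph U F2 g2"
  have dem: "demands U ?D1" "demands U ?D2"
    using assms(1-5) by (auto intro!: demands_demand_graph)
  have finF: "finite F1" "finite F2"
    using assms(1-3) finite_subset[of _ "Pow U"]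
    by (auto simp: intersecting_supermodular_def intersecting_family_def)
  obtain f1 f2 where f: "joint U ?D1 ?D2 f1 f2" using joint_deadlines[OF dem] by blast
  have len: "f1 u + f2 u \<le> card (L u) + 1" if u: "u \<in> U" for u
  proof -
    have "within ?D1 u (f1 u + f2 u - 1) \<or> within ?D2 u (f1 u + f2 u - 1)"
      using f u by (simp add: joint_def)
    then have "f1 u + f2 u - 1 \<le> max (eff_demand F1 g1 u) (eff_demand F2 g2 u)"
      using within_eff_demand finF by (meson max.coboundedI1 max.coboundedI2)
    then show ?thesis using assms(7)[OF u] by linarith
  qed
  \<comment> \<open>An infinite list would have \<open>card\<close> 0, whereas
    \<open>eff_demand\<close> is at least 1.\<close>
  have finL: "finite (L u)" if u: "u \<in> U" for u
  proof (rule card_ge_0_finite)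
    have "1 \<le> eff_demand F1 g1 u"
      by (rule within_eff_demand[OF finF(1), of U]) (simp add: within_def)
    then show "0 < card (L u)" using assms(7)[OF u] by simp
  qed
  \<comment> \<open>\<open>S\<close> may be infinite, so the induction runs over the colours that
    occur in lists.\<close>
  have "finite (\<Union>u\<in>U. L u)" using assms(1) finL by blast
  then have "\<exists>\<phi>. (\<forall>u\<in>U. \<phi> u \<in> L u) \<and> dominates ?D1 \<phi> \<and> dominates ?D2 \<phi>"
    by (rule list_colouring_of_deadlines[OF _ dem])
      (use f len in \<open>auto simp: joint_def\<close>)
  then obtain \<phi> where \<phi>: "\<forall>u\<in>U. \<phi> u \<in> L u" "dominates ?D1 \<phi>" "dominates ?D2 \<phi>"
    by (elim exE conjE)
  have "\<phi> \<in> U \<rightarrow> S" using \<phi>(1) assms(6) by blast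
  moreover have "g X \<le> int (card (\<phi> ` X))" if "dominates (demand_graph U F g) \<phi>" "X \<in> F" for F g X
    using that unfolding dominates_def demand_graph_def by simp
  ultimately have "list_supermodular_coloring U F1 g1 F2 g2 S L \<phi>"
    unfolding list_supermodular_coloring_def using \<phi> by blast
  then show ?thesis by (intro exI[of _ \<phi>])
qed

end
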